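(* Let $\gamma>0$, let $u_a,u_b\in L^\infty(\Omega)$ satisfy $u_a(x)<0<u_b(x)$ for almost all $x\in\Omega$, let $U_{ad}=\{u\in L^2(\Omega): u_a(x)\le u(x)\le u_b(x)\text{ for almost all }x\in\Omega\}$, and let $\bar u$ be a solution (optimal control) of $$\min_{(y,u)\in H_0^1(\Omega)\times L^2(\Omega)}\ \frac12\|y-y_d\|^2_{L^2(\Omega)}+\frac{\alpha}{2}\|u\|^2_{L^2(\Omega)}+\beta\,\Upsilon_{p,\gamma}(u)\quad\text{subject to } u\in U_{ad},\ Ay=u+f\ \text{in }\Omega,\ y=0\ \text{on }\Gamma.$$ Then there exist $\bar y=S(\bar u+f)\in H_0^1(\Omega)$, an adjoint state $\bar\phi\in H_0^1(\Omega)$, a multiplier $\zeta\in L^2(\Omega)$, and $\bar w$ given by $$\bar w(x)=\begin{cases}\Big[\delta_\gamma-\frac1p\Big(|\bar u(x)|+\frac1\gamma\frac{1-p}{p}\Big)^{\frac{1-p}{p}}\Big]\operatorname{sign}(\bar u(x)), & |\bar u(x)|>\frac1\gamma,\\ 0,&\text{otherwise,}\end{cases}$$ such that $$A\bar y=\bar u+f\ \text{in }\Omega,\ \ \bar y=0\ \text{on }\Gamma;\qquad A^*\bar\phi=\bar y-y_d\ \text{in }\Omega,\ \ \bar\phi=0\ \text{on }\Gamma;$$ $$\big(\bar\phi+\alpha\bar u+\beta(\delta_\gamma\zeta-\bar w),\,u-\bar u\big)_{L^2(\Omega)}\ge0\quad\text{for all }u\in U_{ad};$$ and, for almost all $x\in\Omega$: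 $\zeta(x)=1$ if $\bar u(x)>0$, $\zeta(x)=-1$ if $\bar u(x)<0$, $|\zeta(x)|\le1$ if $\bar u(x)=0$. Moreover, there exist $\lambda_a,\lambda_b\in L^2(\Omega)$ such that this optimality system can be written as a KKT system, i.e. with the same state equation, adjoint equation and conditions on $\zeta$, and with the variational inequality replaced by $$\bar\phi+\alpha\bar u+\beta(\delta_\gamma\zeta-\bar w)+\lambda_b-\lambda_a=0,$$ $$\lambda_a\ge0,\quad\lambda_b\ge0,\quad\lambda_a(\bar u-u_a)=0,\quad\lambda_b(u_b-\bar u)=0\quad\text{a.e. in }\Omega.$$
   Context: Let $\Omega\subset\mathbb{R}^n$ ($n=2$ or $n=3$) be a bounded Lipschitz domain with boundary $\Gamma$, let $p>1$, $\alpha>0$, $\beta>0$, and $f,y_d\in L^2(\Omega)$. Let $A$ be the differential operator $(Ay)(x)=-\sum_{i,j=1}^n\frac{\partial}{\partial x_i}\big(a_{ij}(x)\frac{\partial y(x)}{\partial x_j}\big)+c_0\,y(x)$ with $a_{ij}\in C^{0,1}(\bar\Omega)$, $c_0\in L^\infty(\Omega)$, $(a_{ij})$ symmetric, and such that there is $\sigma>0$ with $\sum_{i,j}a_{ij}(x)\xi_i\xi_j\ge\sigma|\xi|^2$ for all $\xi\in\mathbb{R}^n$ and almost all $x\in\Omega$. Put $a(y,v)=\int_\Omega \sum_{i,j}a_{ij}\frac{\partial y}{\partial x_j}\frac{\partial v}{\partial x_i}+c_0yv\,dx$. It is a standing assumption that for each $w\in L^2(\Omega)$ there is a unique $y\in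 H_0^1(\Omega)$ with $a(y,v)=(w,v)_{L^2(\Omega)}$ for all $v\in H_0^1(\Omega)$, and that the linear map $S:L^2(\Omega)\to H_0^1(\Omega)$, $w\mapsto y$, is continuous. Boundary value problems are understood in this weak sense: "$Ay=w$ in $\Omega$, $y=0$ on $\Gamma$" means $y=Sw$. $A^*$ is the adjoint of $A$: "$A^*\phi=w$ in $\Omega$, $\phi=0$ on $\Gamma$" means $\phi\in H^1_0(\Omega)$ and $a(v,\phi)=(w,v)_{L^2(\Omega)}$ for all $v\in H_0^1(\Omega)$. For $\gamma>0$ define $h_{p,\gamma}:\mathbb{R}\to\mathbb{R}$ by $h_{p,\gamma}(v)=\frac{\gamma^{p-1}}{p}|v|^p$ if $|v|\le\frac1\gamma$ and $h_{p,\gamma}(v)=|v|+\frac1\gamma\frac{1-p}{p}$ otherwise; $\Upsilon_{p,\gamma}(u)=\int_\Omega h_{p,\gamma}(u(x))^{1/p}\,dx$; and $\delta_\gamma=\gamma^{\frac{p-1}{p}}/p^{\frac1p}$. *)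

theory Defs
  imports "HOL-Analysis.Analysis"
begin

text \<open>
  Functions on \<open>\<Omega> \<subseteq> \<real>\<^sup>n\<close> are represented by total functions on \<open>real ^ 'n\<close>;
  only their values on \<open>\<Omega>\<close> matter, and elements of $L^2$, $H^1$ etc. are
  representatives, so that equality in these spaces is equality almost everywhere
  with respect to \<open>lebesgue_on \<Omega>\<close>.
\<close>

definition L2_space :: "(real ^ 'n) set \<Rightarrow> (real ^ 'n \<Rightarrow> real) set" where
  "L2_space \<Omega> = {u. u \<in> borel_measurable (lebesgue_on \<Omega>) \<and>
                    integrable (lebesgue_on \<Omega>) (\<lambda>x. (u x)\<^sup>2)}"

definition L2_inner :: "(real ^ 'n) set \<Rightarrow> (real ^ 'n \<Rightarrow> real) \<Rightarrow> (real ^ 'n \<Rightarrow> real) \<Rightarrow> real" where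
  "L2_inner \<Omega> u v = (LINT x|lebesgue_on \<Omega>. u x * v x)"

definition L2_norm :: "(real ^ 'n) set \<Rightarrow> (real ^ 'n \<Rightarrow> real) \<Rightarrow> real" where
  "L2_norm \<Omega> u = sqrt (L2_inner \<Omega> u u)"

definition Linf_space :: "(real ^ 'n) set \<Rightarrow> (real ^ 'n \<Rightarrow> real) set" where
  "Linf_space \<Omega> = {u. u \<in> borel_measurable (lebesgue_on \<Omega>) \<and>
                      (\<exists>C. AE x in lebesgue_on \<Omega>. \<bar>u x\<bar> \<le> C)}"

text \<open>
  Near each boundary point, \<open>\<Omega>\<close> is the part of a ball lying above the graph of a
  Lipschitz function. The orthonormal coordinate system is given by the direction
  \<open>\<nu>\<close> of its last axis: the last coordinate of \<open>x\<close> is \<open>x \<bullet> \<nu>\<close>, and the remaining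
  ones are encoded by the projection of \<open>x\<close> onto the hyperplane orthogonal to \<open>\<nu>\<close>.
\<close>

definition bounded_lipschitz_domain :: "(real ^ 'n) set \<Rightarrow> bool" where
  "bounded_lipschitz_domain \<Omega> \<longleftrightarrow>
     open \<Omega> \<and> connected \<Omega> \<and> \<Omega> \<noteq> {} \<and> bounded \<Omega> \<and>
     (\<forall>z \<in> frontier \<Omega>. \<exists>r > 0. \<exists>\<nu> g L. norm \<nu> = 1 \<and> L-lipschitz_on {v. v \<bullet> \<nu> = 0} g \<and>
        \<Omega> \<inter> ball z r = {x \<in> ball z r. x \<bullet> \<nu> > g (x - (x \<bullet> \<nu>) *\<^sub>R \<nu>)})"

definition partial_deriv :: "'n \<Rightarrow> (real ^ 'n \<Rightarrow> real) \<Rightarrow> real ^ 'n \<Rightarrow> real" where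
  "partial_deriv i f x = frechet_derivative f (at x) (axis i 1)"

primrec Ck :: "nat \<Rightarrow> (real ^ 'n \<Rightarrow> real) \<Rightarrow> bool" where
  "Ck 0 f \<longleftrightarrow> continuous_on UNIV f"
| "Ck (Suc k) f \<longleftrightarrow> f differentiable_on UNIV \<and> (\<forall>i. Ck k (partial_deriv i f))"

definition test_functions :: "(real ^ 'n) set \<Rightarrow> (real ^ 'n \<Rightarrow> real) set" where
  "test_functions \<Omega> = {\<phi>. (\<forall>k. Ck k \<phi>) \<and> compact (closure {x. \<phi> x \<noteq> 0}) \<and>
                          closure {x. \<phi> x \<noteq> 0} \<subseteq> \<Omega>}"

definition is_weak_partial ::
  "(real ^ 'n) set \<Rightarrow> 'n \<Rightarrow> (real ^ 'n \<Rightarrow> real) \<Rightarrow> (real ^ 'n \<Rightarrow> real) \<Rightarrow> bool" where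
  "is_weak_partial \<Omega> i y g \<longleftrightarrow>
     (\<forall>\<phi> \<in> test_functions \<Omega>. L2_inner \<Omega> y (partial_deriv i \<phi>) = - L2_inner \<Omega> g \<phi>)"

definition H1_space :: "(real ^ 'n) set \<Rightarrow> (real ^ 'n \<Rightarrow> real) set" where
  "H1_space \<Omega> = {y \<in> L2_space \<Omega>. \<forall>i. \<exists>g \<in> L2_space \<Omega>. is_weak_partial \<Omega> i y g}"

text \<open>Weak derivatives are unique almost everywhere, so the choice below is harmless on \<open>H1_space \<Omega>\<close>.\<close>

definition weak_partial :: "(real ^ 'n) set \<Rightarrow> 'n \<Rightarrow> (real ^ 'n \<Rightarrow> real) \<Rightarrow> real ^ 'n \<Rightarrow> real" where
  "weak_partial \<Omega> i y = (SOME g. g \<in> L2_space \<Omega> \<and> is_weak_partial \<Omega> i y g)"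

definition H1_norm :: "(real ^ 'n) set \<Rightarrow> (real ^ 'n \<Rightarrow> real) \<Rightarrow> real" where
  "H1_norm \<Omega> y = sqrt ((L2_norm \<Omega> y)\<^sup>2 + (\<Sum>i\<in>UNIV. (L2_norm \<Omega> (weak_partial \<Omega> i y))\<^sup>2))"

definition H10_space :: "(real ^ 'n) set \<Rightarrow> (real ^ 'n \<Rightarrow> real) set" where
  "H10_space \<Omega> = {y \<in> H1_space \<Omega>. \<exists>\<phi>. (\<forall>k. \<phi> k \<in> test_functions \<Omega>) \<and>
                    (\<lambda>k::nat. H1_norm \<Omega> (\<lambda>x. \<phi> k x - y x)) \<longlonglongrightarrow> 0}"

definition elliptic_coefficients ::
  "(real ^ 'n) set \<Rightarrow> ('n \<Rightarrow> 'n \<Rightarrow> real ^ 'n \<Rightarrow> real) \<Rightarrow> (real ^ 'n \<Rightarrow> real) \<Rightarrow> bool" where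
  "elliptic_coefficients \<Omega> a c0 \<longleftrightarrow>
     (\<forall>i j. \<exists>L. L-lipschitz_on (closure \<Omega>) (a i j)) \<and>
     c0 \<in> Linf_space \<Omega> \<and>
     (\<forall>i j. \<forall>x \<in> closure \<Omega>. a i j x = a j i x) \<and>
     (\<exists>\<sigma> > 0. \<forall>\<xi> :: real ^ 'n. AE x in lebesgue_on \<Omega>.
        (\<Sum>i\<in>UNIV. \<Sum>j\<in>UNIV. a i j x * \<xi> $ i * \<xi> $ j) \<ge> \<sigma> * (norm \<xi>)\<^sup>2)"

definition bilinear_form ::
  "(real ^ 'n) set \<Rightarrow> ('n \<Rightarrow> 'n \<Rightarrow> real ^ 'n \<Rightarrow> real) \<Rightarrow> (real ^ 'n \<Rightarrow> real) \<Rightarrow>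
   (real ^ 'n \<Rightarrow> real) \<Rightarrow> (real ^ 'n \<Rightarrow> real) \<Rightarrow> real" where
  "bilinear_form \<Omega> a c0 y v =
     (LINT x|lebesgue_on \<Omega>.
        (\<Sum>i\<in>UNIV. \<Sum>j\<in>UNIV. a i j x * weak_partial \<Omega> j y x * weak_partial \<Omega> i v x)
        + c0 x * y x * v x)"

text \<open>\<open>A y = w\<close> in \<open>\<Omega>\<close>, \<open>y = 0\<close> on the boundary:\<close>

definition state_equation ::
  "(real ^ 'n) set \<Rightarrow> ('n \<Rightarrow> 'n \<Rightarrow> real ^ 'n \<Rightarrow> real) \<Rightarrow> (real ^ 'n \<Rightarrow> real) \<Rightarrow>
   (real ^ 'n \<Rightarrow> real) \<Rightarrow> (real ^ 'n \<Rightarrow> real) \<Rightarrow> bool" where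
  "state_equation \<Omega> a c0 y w \<longleftrightarrow>
     y \<in> H10_space \<Omega> \<and> (\<forall>v \<in> H10_space \<Omega>. bilinear_form \<Omega> a c0 y v = L2_inner \<Omega> w v)"

text \<open>\<open>A\<^sup>* \<phi> = w\<close> in \<open>\<Omega>\<close>, \<open>\<phi> = 0\<close> on the boundary:\<close>

definition adjoint_equation ::
  "(real ^ 'n) set \<Rightarrow> ('n \<Rightarrow> 'n \<Rightarrow> real ^ 'n \<Rightarrow> real) \<Rightarrow> (real ^ 'n \<Rightarrow> real) \<Rightarrow>
   (real ^ 'n \<Rightarrow> real) \<Rightarrow> (real ^ 'n \<Rightarrow> real) \<Rightarrow> bool" where
  "adjoint_equation \<Omega> a c0 \<phi> w \<longleftrightarrow>
     \<phi> \<in> H10_space \<Omega> \<and> (\<forall>v \<in> H10_space \<Omega>. bilinear_form \<Omega> a c0 v \<phi> = L2_inner \<Omega> w v)"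

definition solution_operator ::
  "(real ^ 'n) set \<Rightarrow> ('n \<Rightarrow> 'n \<Rightarrow> real ^ 'n \<Rightarrow> real) \<Rightarrow> (real ^ 'n \<Rightarrow> real) \<Rightarrow>
   (real ^ 'n \<Rightarrow> real) \<Rightarrow> real ^ 'n \<Rightarrow> real" where
  "solution_operator \<Omega> a c0 w = (SOME y. state_equation \<Omega> a c0 y w)"

text \<open>
  Unique solvability for every right-hand side in $L^2$, and continuity of the
  solution operator from $L^2$ to $H^1_0$ (its linearity follows from uniqueness).
\<close>

definition continuously_solvable ::
  "(real ^ 'n) set \<Rightarrow> ('n \<Rightarrow> 'n \<Rightarrow> real ^ 'n \<Rightarrow> real) \<Rightarrow> (real ^ 'n \<Rightarrow> real) \<Rightarrow> bool" where
  "continuously_solvable \<Omega> a c0 \<longleftrightarrow>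
     (\<forall>w \<in> L2_space \<Omega>. (\<exists>y. state_equation \<Omega> a c0 y w) \<and>
        (\<forall>y z. state_equation \<Omega> a c0 y w \<longrightarrow> state_equation \<Omega> a c0 z w \<longrightarrow>
               (AE x in lebesgue_on \<Omega>. y x = z x))) \<and>
     (\<forall>w \<in> L2_space \<Omega>. \<forall>\<epsilon> > 0. \<exists>\<delta> > 0. \<forall>w' \<in> L2_space \<Omega>.
        L2_norm \<Omega> (\<lambda>x. w' x - w x) < \<delta> \<longrightarrow>
        H1_norm \<Omega> (\<lambda>x. solution_operator \<Omega> a c0 w' x - solution_operator \<Omega> a c0 w x) < \<epsilon>)"

definition h_reg :: "real \<Rightarrow> real \<Rightarrow> real \<Rightarrow> real" where
  "h_reg p \<gamma> v = (if \<bar>v\<bar> \<le> 1 / \<gamma> then \<gamma> powr (p - 1) / p * \<bar>v\<bar> powr p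
                  else \<bar>v\<bar> + 1 / \<gamma> * ((1 - p) / p))"

definition Upsilon :: "(real ^ 'n) set \<Rightarrow> real \<Rightarrow> real \<Rightarrow> (real ^ 'n \<Rightarrow> real) \<Rightarrow> real" where
  "Upsilon \<Omega> p \<gamma> u = (LINT x|lebesgue_on \<Omega>. h_reg p \<gamma> (u x) powr (1 / p))"

definition delta_reg :: "real \<Rightarrow> real \<Rightarrow> real" where
  "delta_reg p \<gamma> = \<gamma> powr ((p - 1) / p) / p powr (1 / p)"

definition admissible_controls ::
  "(real ^ 'n) set \<Rightarrow> (real ^ 'n \<Rightarrow> real) \<Rightarrow> (real ^ 'n \<Rightarrow> real) \<Rightarrow> (real ^ 'n \<Rightarrow> real) set" where
  "admissible_controls \<Omega> u\<^sub>a u\<^sub>b =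
     {u \<in> L2_space \<Omega>. AE x in lebesgue_on \<Omega>. u\<^sub>a x \<le> u x \<and> u x \<le> u\<^sub>b x}"

definition cost_functional ::
  "(real ^ 'n) set \<Rightarrow> (real ^ 'n \<Rightarrow> real) \<Rightarrow> real \<Rightarrow> real \<Rightarrow> real \<Rightarrow> real \<Rightarrow>
   (real ^ 'n \<Rightarrow> real) \<times> (real ^ 'n \<Rightarrow> real) \<Rightarrow> real" where
  "cost_functional \<Omega> y\<^sub>d \<alpha> \<beta> p \<gamma> = (\<lambda>(y, u).
     1 / 2 * (L2_norm \<Omega> (\<lambda>x. y x - y\<^sub>d x))\<^sup>2 + \<alpha> / 2 * (L2_norm \<Omega> u)\<^sup>2 + \<beta> * Upsilon \<Omega> p \<gamma> u)"

definition feasible_pairs ::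
  "(real ^ 'n) set \<Rightarrow> ('n \<Rightarrow> 'n \<Rightarrow> real ^ 'n \<Rightarrow> real) \<Rightarrow> (real ^ 'n \<Rightarrow> real) \<Rightarrow>
   (real ^ 'n \<Rightarrow> real) \<Rightarrow> (real ^ 'n \<Rightarrow> real) \<Rightarrow> (real ^ 'n \<Rightarrow> real) \<Rightarrow>
   ((real ^ 'n \<Rightarrow> real) \<times> (real ^ 'n \<Rightarrow> real)) set" where
  "feasible_pairs \<Omega> a c0 f u\<^sub>a u\<^sub>b =
     {(y, u). u \<in> admissible_controls \<Omega> u\<^sub>a u\<^sub>b \<and> state_equation \<Omega> a c0 y (\<lambda>x. u x + f x)}"

definition optimal_control ::
  "(real ^ 'n) set \<Rightarrow> ('n \<Rightarrow> 'n \<Rightarrow> real ^ 'n \<Rightarrow> real) \<Rightarrow> (real ^ 'n \<Rightarrow> real) \<Rightarrow>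
   (real ^ 'n \<Rightarrow> real) \<Rightarrow> (real ^ 'n \<Rightarrow> real) \<Rightarrow> real \<Rightarrow> real \<Rightarrow> real \<Rightarrow> real \<Rightarrow>
   (real ^ 'n \<Rightarrow> real) \<Rightarrow> (real ^ 'n \<Rightarrow> real) \<Rightarrow> (real ^ 'n \<Rightarrow> real) \<Rightarrow> bool" where
  "optimal_control \<Omega> a c0 f y\<^sub>d \<alpha> \<beta> p \<gamma> u\<^sub>a u\<^sub>b u \<longleftrightarrow>
     (\<exists>y. is_arg_min (cost_functional \<Omega> y\<^sub>d \<alpha> \<beta> p \<gamma>)
            (\<lambda>z. z \<in> feasible_pairs \<Omega> a c0 f u\<^sub>a u\<^sub>b) (y, u))"

end

theory Submission
  imports Defs
begin

text \<open>
  The integrand of \<open>Upsilon\<close> is \<open>h_reg p \<gamma> v powr (1 / p) = \<delta> * \<bar>v\<bar> - W v\<close> with \<open>\<delta> = delta_reg p \<gamma>\<close>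
  and \<open>W\<close> convex and continuously differentiable, \<open>W' = w_reg p \<gamma>\<close>. Hence along \<open>u\<^sub>0 + t (u - u\<^sub>0)\<close> the
  cost is bounded above by a smooth perturbation of \<open>\<beta> \<delta> \<parallel>\<cdot>\<parallel>\<close> in $L^1$, which matches it to first order
  at \<open>t = 0\<close>; dividing by \<open>t\<close> and letting \<open>t\<close> tend to \<open>0\<close> gives a variational inequality with the
  directional derivative of the absolute value. Localizing it to measurable sets makes it pointwise,
  and testing with \<open>u\<^sub>a\<close> and \<open>u\<^sub>b\<close> suffices to read off \<open>\<zeta>\<close> and both multipliers: where \<open>u\<^sub>0 = 0\<close> the
  bounds are inactive, so \<open>\<zeta>\<close> is chosen there to make the gradient vanish.

  Since the bilinear form is symmetric, the adjoint state is the state for the right-hand side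
  \<open>y - y\<^sub>d\<close>, and the solution operator is self-adjoint in $L^2$. Self-adjointness already implies
  linearity in $L^2$, so neither linearity nor uniqueness of weak derivatives is ever needed.
\<close>

section \<open>Pointwise concavity estimates for the regularized integrand\<close>

text \<open>Concavity of the power without derivatives: the weighted AM-GM inequality, multiplied by
  \<open>y powr (q - 1)\<close>.\<close>

lemma powr_le_tangent:
  fixes x y q :: real
  assumes "0 < x" "0 < y" "0 < q" "q < 1"
  shows "x powr q \<le> y powr q + q * y powr (q - 1) * (x - y)"
proof -
  have "x powr q * y powr (1 - q) \<le> q * x + (1 - q) * y"
    using assms by (intro Youngs_inequality_0) auto
  then have "x powr q * y powr (1 - q) * y powr (q - 1) \<le> (q * x + (1 - q) * y) * y powr (q - 1)"
    by (rule mult_right_mono) simp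
  moreover have "y powr (1 - q) * y powr (q - 1) = 1"
    using assms by (simp flip: powr_add)
  moreover have "y * y powr (q - 1) = y powr q"
    using assms by (simp add: powr_mult_base)
  ultimately show ?thesis
    by (simp add: algebra_simps)
qed

definition w_reg :: "real \<Rightarrow> real \<Rightarrow> real \<Rightarrow> real" where
  "w_reg p \<gamma> v = (if \<bar>v\<bar> > 1 / \<gamma>
     then (delta_reg p \<gamma> - 1 / p * (\<bar>v\<bar> + 1 / \<gamma> * ((1 - p) / p)) powr ((1 - p) / p)) * sgn v
     else 0)"

lemma delta_reg_pos: "p > 1 \<Longrightarrow> \<gamma> > 0 \<Longrightarrow> delta_reg p \<gamma> > 0"
  by (simp add: delta_reg_def)

lemma h_reg_root:
  assumes "p > 1" "\<gamma> > 0"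
  shows "h_reg p \<gamma> v powr (1 / p) =
    (if \<bar>v\<bar> \<le> 1 / \<gamma> then delta_reg p \<gamma> * \<bar>v\<bar>
     else (\<bar>v\<bar> + 1 / \<gamma> * ((1 - p) / p)) powr (1 / p))"
  using assms by (simp add: h_reg_def delta_reg_def powr_mult powr_divide powr_powr)

text \<open>At \<open>r = 1 / \<gamma>\<close> the shifted argument is exactly
  \<open>1 / (p * \<gamma>)\<close>, and it grows with \<open>r\<close>. The base of the power
  branch therefore stays positive, as the tangent inequality and the monotonicity of powers
  require.\<close>

lemma shifted_arg_bounds:
  fixes p \<gamma> r :: real
  assumes "p > 1" "\<gamma> > 0" "r \<ge> 1 / \<gamma>"
  shows "r + 1 / \<gamma> * ((1 - p) / p) \<ge> 1 / (p * \<gamma>)" and "r + 1 / \<gamma> * ((1 - p) / p) > 0"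
proof -
  have "1 / \<gamma> + 1 / \<gamma> * ((1 - p) / p) = 1 / (p * \<gamma>)"
    using assms by (simp add: field_simps)
  then show "r + 1 / \<gamma> * ((1 - p) / p) \<ge> 1 / (p * \<gamma>)"
    using assms by linarith
  moreover have "1 / (p * \<gamma>) > 0"
    using assms by simp
  ultimately show "r + 1 / \<gamma> * ((1 - p) / p) > 0"
    by linarith
qed

text \<open>Matching at the transition \<open>\<bar>v\<bar> = 1 / \<gamma>\<close>: there the power
  branch of the integrand has the value and the slope of the linear branch, so the branches join
  continuously differentiably.\<close>

lemma delta_reg_eq:
  assumes "p > 1" "\<gamma> > 0"
  shows "(1 / (p * \<gamma>)) powr (1 / p) = delta_reg p \<gamma> / \<gamma>"
    and "1 / p * (1 / (p * \<gamma>)) powr ((1 - p) / p) = delta_reg p \<gamma>"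
proof -
  have p: "p powr (1 / p - 1) = p powr (1 / p) / p" "p powr (1 - 1 / p) = p / p powr (1 / p)"
    and g: "\<gamma> powr (1 - 1 / p) = \<gamma> / \<gamma> powr (1 / p)" "\<gamma> powr (1 / p - 1) = \<gamma> powr (1 / p) / \<gamma>"
    using assms by (simp_all add: powr_diff)
  have e: "(1 - p) / p = 1 / p - 1" "(p - 1) / p = 1 - 1 / p"
    using assms by (simp_all add: field_simps)
  show "(1 / (p * \<gamma>)) powr (1 / p) = delta_reg p \<gamma> / \<gamma>"
    using assms by (simp add: delta_reg_def e g powr_divide powr_mult)
  show "1 / p * (1 / (p * \<gamma>)) powr ((1 - p) / p) = delta_reg p \<gamma>"
    using assms by (simp add: delta_reg_def e g p powr_divide powr_mult)
qed

text \<open>The integrand is \<open>j \<bar>v\<bar>\<close> with \<open>j\<close> concave: linear up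
  to the transition, a power beyond it. The tangent of \<open>j\<close> at
  \<open>\<bar>a\<bar>\<close> has slope \<open>j' \<bar>a\<bar>\<close>. Written as
  \<open>\<delta>\<close> minus the nonnegative number \<open>\<delta> - j' \<bar>a\<bar>\<close>,
  it splits the estimate into the nonsmooth part with constant coefficient \<open>\<delta>\<close>
  and a remainder, which is linearized by a subgradient of the absolute value.\<close>

lemma h_reg_root_diff_le:
  assumes p: "p > 1" and g: "\<gamma> > 0"
  shows "h_reg p \<gamma> b powr (1 / p) - h_reg p \<gamma> a powr (1 / p)
    \<le> delta_reg p \<gamma> * (\<bar>b\<bar> - \<bar>a\<bar>) - w_reg p \<gamma> a * (b - a)"
proof -
  define \<delta> where "\<delta> = delta_reg p \<gamma>"
  define s where "s r = r + 1 / \<gamma> * ((1 - p) / p)" for r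
  define k where "k r = s r powr (1 / p)" for r
  define k' where "k' r = 1 / p * s r powr ((1 - p) / p)" for r
  define j where "j r = (if r \<le> 1 / \<gamma> then \<delta> * r else k r)" for r
  define j' where "j' r = (if r \<le> 1 / \<gamma> then \<delta> else k' r)" for r
  have s_pos: "s r > 0" if "r \<ge> 1 / \<gamma>" for r
    using shifted_arg_bounds[OF p g that] by (simp add: s_def)
  have s_edge: "s (1 / \<gamma>) = 1 / (p * \<gamma>)"
    using p g by (simp add: s_def field_simps)
  have k_edge: "k (1 / \<gamma>) = \<delta> / \<gamma>" and k'_edge: "k' (1 / \<gamma>) = \<delta>"
    unfolding k_def k'_def s_edge \<delta>_def using delta_reg_eq[OF p g] by auto
  have k_tangent: "k x \<le> k y + k' y * (x - y)" if "x \<ge> 1 / \<gamma>" "y \<ge> 1 / \<gamma>" for x y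
  proof -
    have "1 / p - 1 = (1 - p) / p" "s x - s y = x - y"
      using p by (simp_all add: field_simps s_def)
    then show ?thesis
      using powr_le_tangent[of "s x" "s y" "1 / p"] s_pos that p by (simp add: k_def k'_def)
  qed
  have k'_le: "k' r \<le> \<delta>" if "r \<ge> 1 / \<gamma>" for r
  proof -
    have "s r powr ((1 - p) / p) \<le> s (1 / \<gamma>) powr ((1 - p) / p)"
      using s_pos[of "1 / \<gamma>"] that p by (intro powr_mono2') (auto simp: s_def divide_nonpos_pos)
    then show ?thesis
      using p k'_edge divide_right_mono[of "s r powr ((1 - p) / p)" _ p] by (force simp: k'_def)
  qed
  \<comment> \<open>The two mixed cases pass through the transition point
    \<open>1 / \<gamma>\<close>. If \<open>x\<close> lies on the linear part and \<open>y\<close>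
    beyond it, \<open>k' y \<le> \<delta>\<close> controls the piece between \<open>x\<close> and
    \<open>1 / \<gamma>\<close>.\<close>
  have j_tangent: "j x \<le> j y + j' y * (x - y)" for x y
  proof (cases "x \<le> 1 / \<gamma>"; cases "y \<le> 1 / \<gamma>")
    assume "x \<le> 1 / \<gamma>" "y \<le> 1 / \<gamma>"
    then show ?thesis by (simp add: j_def j'_def algebra_simps)
  next
    assume x: "x \<le> 1 / \<gamma>" and y: "\<not> y \<le> 1 / \<gamma>"
    have "\<delta> / \<gamma> \<le> k y + k' y * (1 / \<gamma> - y)"
      using k_tangent[of "1 / \<gamma>" y] y k_edge by simp
    moreover have "k' y * (1 / \<gamma> - x) \<le> \<delta> * (1 / \<gamma> - x)"
      using k'_le[of y] x y by (intro mult_right_mono) auto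
    ultimately show ?thesis using x y by (simp add: j_def j'_def algebra_simps)
  next
    assume x: "\<not> x \<le> 1 / \<gamma>" and y: "y \<le> 1 / \<gamma>"
    have "k x \<le> \<delta> / \<gamma> + \<delta> * (x - 1 / \<gamma>)"
      using k_tangent[of x "1 / \<gamma>"] x k_edge k'_edge by simp
    then show ?thesis using x y by (simp add: j_def j'_def algebra_simps)
  next
    assume "\<not> x \<le> 1 / \<gamma>" "\<not> y \<le> 1 / \<gamma>"
    then show ?thesis using k_tangent[of x y] by (simp add: j_def j'_def)
  qed
  have h: "h_reg p \<gamma> v powr (1 / p) = j \<bar>v\<bar>" for v
    unfolding h_reg_root[OF p g] by (simp add: j_def k_def s_def \<delta>_def)
  have w: "w_reg p \<gamma> a = (\<delta> - j' \<bar>a\<bar>) * sgn a"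
    by (simp add: w_reg_def j'_def k'_def s_def \<delta>_def)
  have "j' \<bar>a\<bar> \<le> \<delta>"
    using k'_le by (simp add: j'_def)
  \<comment> \<open>\<open>sgn a\<close> is a subgradient of the absolute value at \<open>a\<close>,
    also for \<open>a = 0\<close>, where it is \<open>0\<close>.\<close>
  moreover have "sgn a * (b - a) \<le> \<bar>b\<bar> - \<bar>a\<bar>"
    by (auto simp: sgn_if)
  ultimately have "(\<delta> - j' \<bar>a\<bar>) * (sgn a * (b - a)) \<le> (\<delta> - j' \<bar>a\<bar>) * (\<bar>b\<bar> - \<bar>a\<bar>)"
    by (intro mult_left_mono) auto
  with j_tangent[of "\<bar>b\<bar>" "\<bar>a\<bar>"] show ?thesis
    unfolding h w \<delta>_def[symmetric] by (simp add: algebra_simps)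
qed

lemma h_reg_root_le:
  assumes "p > 1" "\<gamma> > 0"
  shows "h_reg p \<gamma> v powr (1 / p) \<le> delta_reg p \<gamma> * \<bar>v\<bar>"
  using h_reg_root_diff_le[OF assms, of v 0] assms by (simp add: h_reg_def w_reg_def)

text \<open>The slope of the power branch is nonnegative and at most its value
  \<open>delta_reg p \<gamma>\<close> at the transition, so the bracket lies between
  \<open>0\<close> and \<open>delta_reg p \<gamma>\<close>. The uniform bound makes
  \<open>w_reg\<close> of a control square integrable on a set of finite measure.\<close>

lemma abs_w_reg_le:
  assumes p: "p > 1" and g: "\<gamma> > 0"
  shows "\<bar>w_reg p \<gamma> v\<bar> \<le> delta_reg p \<gamma>"
proof (cases "\<bar>v\<bar> > 1 / \<gamma>")
  case True
  define s where "s = \<bar>v\<bar> + 1 / \<gamma> * ((1 - p) / p)"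
  have "s powr ((1 - p) / p) \<le> (1 / (p * \<gamma>)) powr ((1 - p) / p)"
    using shifted_arg_bounds[OF p g, of "\<bar>v\<bar>"] True p g
    by (intro powr_mono2') (auto simp: s_def divide_nonpos_pos)
  then have "1 / p * s powr ((1 - p) / p) \<le> 1 / p * (1 / (p * \<gamma>)) powr ((1 - p) / p)"
    using p by (intro mult_left_mono) auto
  then have "1 / p * s powr ((1 - p) / p) \<le> delta_reg p \<gamma>"
    unfolding delta_reg_eq(2)[OF p g] .
  moreover have "1 / p * s powr ((1 - p) / p) \<ge> 0"
    using p by simp
  ultimately have "\<bar>delta_reg p \<gamma> - 1 / p * s powr ((1 - p) / p)\<bar> \<le> delta_reg p \<gamma>"
    by linarith
  moreover have "\<bar>sgn v\<bar> \<le> 1"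
    by (simp add: sgn_if)
  ultimately have "\<bar>delta_reg p \<gamma> - 1 / p * s powr ((1 - p) / p)\<bar> * \<bar>sgn v\<bar> \<le> delta_reg p \<gamma> * 1"
    using delta_reg_pos[OF p g] by (intro mult_mono) auto
  then show ?thesis
    using True by (simp only: w_reg_def if_True abs_mult s_def mult_1_right)
next
  case False
  then show ?thesis
    using delta_reg_pos[OF p g] by (simp add: w_reg_def)
qed

section \<open>The directional derivative of the absolute value\<close>

text \<open>The derivative is one-sided. At \<open>v = 0\<close> it is positively homogeneous but
  not linear in \<open>d\<close>; this is the source of the interval of values for
  \<open>\<zeta>\<close> there.\<close>

definition abs_dir_deriv :: "real \<Rightarrow> real \<Rightarrow> real" where
  "abs_dir_deriv v d = (if v = 0 then \<bar>d\<bar> else sgn v * d)"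

text \<open>For \<open>v = 0\<close> the quotient does not depend on \<open>n\<close>. Otherwise the
  perturbed point eventually keeps the sign of \<open>v\<close>, and from then on the quotient
  equals its limit.\<close>

lemma abs_dir_deriv_tendsto:
  "(\<lambda>n. real (Suc n) * (\<bar>v + inverse (real (Suc n)) * d\<bar> - \<bar>v\<bar>)) \<longlonglongrightarrow> abs_dir_deriv v d"
proof (cases "v = 0")
  case True
  have "real (Suc n) * (\<bar>v + inverse (real (Suc n)) * d\<bar> - \<bar>v\<bar>) = \<bar>d\<bar>" for n
    using True by (simp add: abs_mult field_simps del: of_nat_Suc)
  then show ?thesis
    using True by (simp add: abs_dir_deriv_def)
next
  case False
  have "(\<lambda>n. inverse (real (Suc n)) * d) \<longlonglongrightarrow> 0"
    using tendsto_mult_left_zero[OF LIMSEQ_inverse_real_of_nat] .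
  then have "\<forall>\<^sub>F n in sequentially. \<bar>inverse (real (Suc n)) * d\<bar> < \<bar>v\<bar>"
    using False by (auto simp: tendsto_iff dist_real_def simp del: of_nat_Suc)
  then have "\<forall>\<^sub>F n in sequentially.
      real (Suc n) * (\<bar>v + inverse (real (Suc n)) * d\<bar> - \<bar>v\<bar>) = abs_dir_deriv v d"
  proof eventually_elim
    case (elim n)
    then have "\<bar>v + inverse (real (Suc n)) * d\<bar> - \<bar>v\<bar> = sgn v * (inverse (real (Suc n)) * d)"
      using False by (auto simp: sgn_if abs_if split: if_splits)
    then show ?case
      using False by (simp add: abs_dir_deriv_def field_simps del: of_nat_Suc)
  qed
  then show ?thesis
    by (rule tendsto_eventually)
qed

text \<open>The reverse triangle inequality. It supplies the majorant, independent of
  \<open>n\<close>, for dominated convergence.\<close>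

lemma abs_diff_quotient_le:
  "\<bar>real (Suc n) * (\<bar>v + inverse (real (Suc n)) * d\<bar> - \<bar>v\<bar>)\<bar> \<le> \<bar>d\<bar>"
proof -
  have "\<bar>\<bar>v + inverse (real (Suc n)) * d\<bar> - \<bar>v\<bar>\<bar> \<le> \<bar>inverse (real (Suc n)) * d\<bar>"
    by linarith
  then have "real (Suc n) * \<bar>\<bar>v + inverse (real (Suc n)) * d\<bar> - \<bar>v\<bar>\<bar>
      \<le> real (Suc n) * \<bar>inverse (real (Suc n)) * d\<bar>"
    by (intro mult_left_mono) simp_all
  also have "\<dots> = \<bar>d\<bar>"
    by (simp add: abs_mult field_simps del: of_nat_Suc)
  finally show ?thesis
    by (simp add: abs_mult del: of_nat_Suc)
qed

section \<open>Square integrable functions, localization of integrals and measurability\<close>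

lemma L2_spaceD:
  assumes "u \<in> L2_space \<Omega>"
  shows "u \<in> borel_measurable (lebesgue_on \<Omega>)" "integrable (lebesgue_on \<Omega>) (\<lambda>x. (u x)\<^sup>2)"
  using assms by (auto simp: L2_space_def)

lemma L2_integrable_mult:
  assumes u: "u \<in> L2_space \<Omega>" and v: "v \<in> L2_space \<Omega>"
  shows "integrable (lebesgue_on \<Omega>) (\<lambda>x. u x * v x)"
proof (rule Bochner_Integration.integrable_bound)
  show "integrable (lebesgue_on \<Omega>) (\<lambda>x. (u x)\<^sup>2 + (v x)\<^sup>2)"
    using L2_spaceD(2) u v by (intro Bochner_Integration.integrable_add) auto
  show "(\<lambda>x. u x * v x) \<in> borel_measurable (lebesgue_on \<Omega>)"
    using L2_spaceD(1) u v by measurable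
  have "\<bar>r * s\<bar> \<le> r\<^sup>2 + s\<^sup>2" for r s :: real
  proof -
    have "2 * (\<bar>r\<bar> * \<bar>s\<bar>) \<le> r\<^sup>2 + s\<^sup>2"
      using zero_le_power2[of "\<bar>r\<bar> - \<bar>s\<bar>"] by (simp add: power2_diff)
    moreover have "0 \<le> \<bar>r\<bar> * \<bar>s\<bar>" by simp
    ultimately show ?thesis by (simp only: abs_mult)
  qed
  then show "AE x in lebesgue_on \<Omega>. norm (u x * v x) \<le> norm ((u x)\<^sup>2 + (v x)\<^sup>2)"
    by (intro AE_I2) simp
qed

lemma L2_add:
  assumes u: "u \<in> L2_space \<Omega>" and v: "v \<in> L2_space \<Omega>"
  shows "(\<lambda>x. u x + v x) \<in> L2_space \<Omega>"
proof -
  have "integrable (lebesgue_on \<Omega>) (\<lambda>x. (u x)\<^sup>2 + (v x)\<^sup>2 + 2 * (u x * v x))"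
    using L2_spaceD(2)[OF u] L2_spaceD(2)[OF v] L2_integrable_mult[OF u v] by simp
  then show ?thesis
    using L2_spaceD(1)[OF u] L2_spaceD(1)[OF v]
    by (simp add: L2_space_def power2_sum mult.assoc)
qed

lemma L2_cmult: "u \<in> L2_space \<Omega> \<Longrightarrow> (\<lambda>x. c * u x) \<in> L2_space \<Omega>"
  by (auto simp: L2_space_def power_mult_distrib)

lemma L2_diff: "u \<in> L2_space \<Omega> \<Longrightarrow> v \<in> L2_space \<Omega> \<Longrightarrow> (\<lambda>x. u x - v x) \<in> L2_space \<Omega>"
  using L2_add[OF _ L2_cmult[of v \<Omega> "- 1"], of u] by simp

lemma L2_inner_commute: "L2_inner \<Omega> u v = L2_inner \<Omega> v u"
  by (simp add: L2_inner_def mult.commute)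

lemma L2_inner_self_nonneg: "L2_inner \<Omega> u u \<ge> 0"
  by (simp add: L2_inner_def)

lemma L2_norm_power2: "(L2_norm \<Omega> u)\<^sup>2 = L2_inner \<Omega> u u"
  by (simp add: L2_norm_def L2_inner_self_nonneg)

lemma L2_inner_add_left:
  "u \<in> L2_space \<Omega> \<Longrightarrow> v \<in> L2_space \<Omega> \<Longrightarrow> w \<in> L2_space \<Omega> \<Longrightarrow>
   L2_inner \<Omega> (\<lambda>x. u x + v x) w = L2_inner \<Omega> u w + L2_inner \<Omega> v w"
  by (simp add: L2_inner_def distrib_right L2_integrable_mult)

lemma L2_inner_diff_left:
  "u \<in> L2_space \<Omega> \<Longrightarrow> v \<in> L2_space \<Omega> \<Longrightarrow> w \<in> L2_space \<Omega> \<Longrightarrow>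
   L2_inner \<Omega> (\<lambda>x. u x - v x) w = L2_inner \<Omega> u w - L2_inner \<Omega> v w"
  by (simp add: L2_inner_def left_diff_distrib L2_integrable_mult)

lemma L2_inner_cmult_left: "L2_inner \<Omega> (\<lambda>x. c * u x) w = c * L2_inner \<Omega> u w"
  by (simp add: L2_inner_def mult.assoc)

lemmas L2_inner_linear_left = L2_inner_add_left L2_inner_diff_left L2_inner_cmult_left

lemma L2_inner_linear_right:
  "u \<in> L2_space \<Omega> \<Longrightarrow> v \<in> L2_space \<Omega> \<Longrightarrow> w \<in> L2_space \<Omega> \<Longrightarrow>
   L2_inner \<Omega> w (\<lambda>x. u x + v x) = L2_inner \<Omega> w u + L2_inner \<Omega> w v"
  "u \<in> L2_space \<Omega> \<Longrightarrow> v \<in> L2_space \<Omega> \<Longrightarrow> w \<in> L2_space \<Omega> \<Longrightarrow>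
   L2_inner \<Omega> w (\<lambda>x. u x - v x) = L2_inner \<Omega> w u - L2_inner \<Omega> w v"
  "L2_inner \<Omega> w (\<lambda>x. c * u x) = c * L2_inner \<Omega> w u"
  by (simp_all add: L2_inner_def distrib_left right_diff_distrib mult.left_commute L2_integrable_mult)

lemma Linf_space_subset_L2:
  assumes "finite_measure (lebesgue_on \<Omega>)" "u \<in> Linf_space \<Omega>"
  shows "u \<in> L2_space \<Omega>"
proof -
  interpret finite_measure "lebesgue_on \<Omega>" by fact
  obtain C where u: "u \<in> borel_measurable (lebesgue_on \<Omega>)" and C: "AE x in lebesgue_on \<Omega>. \<bar>u x\<bar> \<le> C"
    using assms by (auto simp: Linf_space_def)
  have "AE x in lebesgue_on \<Omega>. norm ((u x)\<^sup>2) \<le> C\<^sup>2"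
    using C by eventually_elim (simp add: abs_le_square_iff[symmetric])
  then show ?thesis
    using u by (auto simp: L2_space_def intro!: integrable_const_bound)
qed

lemma L2_integrable:
  assumes "finite_measure (lebesgue_on \<Omega>)" "u \<in> L2_space \<Omega>"
  shows "integrable (lebesgue_on \<Omega>) u"
proof -
  interpret finite_measure "lebesgue_on \<Omega>" by fact
  have "(\<lambda>_. 1) \<in> L2_space \<Omega>"
    by (simp add: L2_space_def)
  from L2_integrable_mult[OF assms(2) this] show ?thesis by simp
qed

text \<open>Testing with the set where \<open>F\<close> is negative gives a nonnegative integral of
  a nonpositive function, which must then vanish almost everywhere.\<close>

lemma AE_nonneg_if_integral_over_sets_nonneg:
  fixes F :: "'a \<Rightarrow> real"
  assumes F: "integrable M F"
    and A: "\<And>A. A \<in> sets M \<Longrightarrow> 0 \<le> (LINT x|M. indicator A x * F x)"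
  shows "AE x in M. 0 \<le> F x"
proof -
  define N where "N = {x \<in> space M. F x < 0}"
  have N: "N \<in> sets M"
    using F unfolding N_def by measurable
  have int: "integrable M (\<lambda>x. indicator N x * F x)"
    using integrable_mult_indicator[OF N F] by simp
  have nonneg: "AE x in M. 0 \<le> - (indicator N x * F x)"
    by (intro AE_I2) (auto simp: N_def indicator_def)
  have "(LINT x|M. - (indicator N x * F x)) \<le> 0"
    using A[OF N] by simp
  moreover have "(LINT x|M. - (indicator N x * F x)) \<ge> 0"
    using nonneg by (rule integral_nonneg_AE)
  ultimately have "(LINT x|M. - (indicator N x * F x)) = 0"
    by (rule antisym)
  then have "AE x in M. - (indicator N x * F x) = 0"
    using integral_nonneg_eq_0_iff_AE[OF integrable_minus[OF int] nonneg] by blast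
  with AE_space show ?thesis
    by eventually_elim (auto simp: N_def indicator_def not_less split: if_splits)
qed

lemma measurable_abs_dir_deriv [measurable]:
  assumes [measurable]: "f \<in> borel_measurable M" "g \<in> borel_measurable M"
  shows "(\<lambda>x. abs_dir_deriv (f x) (g x)) \<in> borel_measurable M"
  unfolding abs_dir_deriv_def by measurable

lemma measurable_w_reg [measurable]:
  assumes [measurable]: "f \<in> borel_measurable M"
  shows "(\<lambda>x. w_reg p \<gamma> (f x)) \<in> borel_measurable M"
  unfolding w_reg_def by measurable

lemma measurable_h_reg [measurable]:
  assumes [measurable]: "f \<in> borel_measurable M"
  shows "(\<lambda>x. h_reg p \<gamma> (f x)) \<in> borel_measurable M"
  unfolding h_reg_def by measurable

lemma abs_abs_dir_deriv_le: "\<bar>abs_dir_deriv v d\<bar> \<le> \<bar>d\<bar>"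
  by (auto simp: abs_dir_deriv_def abs_mult sgn_if)

section \<open>Symmetry of the bilinear form and self-adjointness of the solution operator\<close>

text \<open>The coefficient matrix is symmetric at every point of the closure, so the two integrands
  agree pointwise after exchanging the summation indices.\<close>

lemma bilinear_form_commute:
  assumes "elliptic_coefficients \<Omega> a c0" "\<Omega> \<in> sets lebesgue"
  shows "bilinear_form \<Omega> a c0 y v = bilinear_form \<Omega> a c0 v y"
  unfolding bilinear_form_def
proof (rule Bochner_Integration.integral_cong[OF refl])
  fix x assume "x \<in> space (lebesgue_on \<Omega>)"
  then have "x \<in> closure \<Omega>"
    using assms(2) closure_subset by (auto simp: space_restrict_space)
  then have a: "a i j x = a j i x" for i j
    using assms(1) by (auto simp: elliptic_coefficients_def)
  have "(\<Sum>i\<in>UNIV. \<Sum>j\<in>UNIV. a i j x * weak_partial \<Omega> j y x * weak_partial \<Omega> i v x)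
      = (\<Sum>j\<in>UNIV. \<Sum>i\<in>UNIV. a i j x * weak_partial \<Omega> j y x * weak_partial \<Omega> i v x)"
    by (rule sum.swap)
  also have "\<dots> = (\<Sum>i\<in>UNIV. \<Sum>j\<in>UNIV. a i j x * weak_partial \<Omega> j v x * weak_partial \<Omega> i y x)"
    by (intro sum.cong refl) (subst a, simp)
  finally show "(\<Sum>i\<in>UNIV. \<Sum>j\<in>UNIV. a i j x * weak_partial \<Omega> j y x * weak_partial \<Omega> i v x) + c0 x * y x * v x
      = (\<Sum>i\<in>UNIV. \<Sum>j\<in>UNIV. a i j x * weak_partial \<Omega> j v x * weak_partial \<Omega> i y x) + c0 x * v x * y x"
    by simp
qed

text \<open>Each weak equation is tested with the solution of the other; symmetry of the form
  identifies the two left-hand sides.\<close>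

lemma state_equation_symmetric:
  assumes "elliptic_coefficients \<Omega> a c0" "\<Omega> \<in> sets lebesgue"
    and "state_equation \<Omega> a c0 y v" "state_equation \<Omega> a c0 z w"
  shows "L2_inner \<Omega> y w = L2_inner \<Omega> v z"
proof -
  have "L2_inner \<Omega> v z = bilinear_form \<Omega> a c0 y z" "L2_inner \<Omega> w y = bilinear_form \<Omega> a c0 z y"
    using assms(3,4) by (auto simp: state_equation_def)
  then show ?thesis
    using bilinear_form_commute[OF assms(1,2)] L2_inner_commute by metis
qed

lemma H10_space_subset_L2: "y \<in> H10_space \<Omega> \<Longrightarrow> y \<in> L2_space \<Omega>"
  by (auto simp: H10_space_def H1_space_def)

lemma state_equation_L2: "state_equation \<Omega> a c0 y w \<Longrightarrow> y \<in> L2_space \<Omega>"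
  by (auto simp: state_equation_def H10_space_subset_L2)

section \<open>Reading off the multipliers at a single point\<close>

text \<open>For \<open>u \<noteq> 0\<close> the directional expression is linear in the direction
  with slope \<open>\<xi>\<close>, and the two tests force \<open>u\<close> onto the bound selected
  by the sign of \<open>\<xi>\<close>. For \<open>u = 0\<close> they give
  \<open>\<bar>g\<bar> \<le> k\<close>, so \<open>\<zeta> = - g / k\<close> is allowed and makes
  \<open>\<xi>\<close> vanish.\<close>

lemma pointwise_multipliers:
  fixes u ua ub g k \<zeta> \<xi> :: real
  assumes k: "k > 0" and u: "ua < 0" "0 < ub" "ua \<le> u" "u \<le> ub"
    and vi: "g * (ua - u) + k * abs_dir_deriv u (ua - u) \<ge> 0" "g * (ub - u) + k * abs_dir_deriv u (ub - u) \<ge> 0"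
  defines "\<zeta> \<equiv> if u = 0 then - g / k else sgn u"
  defines "\<xi> \<equiv> g + k * \<zeta>"
  shows "\<bar>\<zeta>\<bar> \<le> 1"
    and "ua \<le> v \<Longrightarrow> v \<le> ub \<Longrightarrow> \<xi> * (v - u) \<ge> 0"
    and "max \<xi> 0 * (u - ua) = 0" and "max (- \<xi>) 0 * (ub - u) = 0"
proof -
  have *: "\<bar>\<zeta>\<bar> \<le> 1 \<and> (\<xi> > 0 \<longrightarrow> u = ua) \<and> (\<xi> < 0 \<longrightarrow> u = ub)"
  proof (cases "u = 0")
    case True
    \<comment> \<open>With \<open>u = 0\<close> the directions are \<open>ua < 0\<close> and
      \<open>ub > 0\<close>, hence \<open>\<bar>ua\<bar> = - ua\<close> and
      \<open>\<bar>ub\<bar> = ub\<close>. Dividing by these signs bounds \<open>g\<close> above by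
      \<open>k\<close> and below by \<open>- k\<close>.\<close>
    have "(g - k) * ua \<ge> 0" "(g + k) * ub \<ge> 0"
      using vi True u by (auto simp: abs_dir_deriv_def algebra_simps)
    then have "\<bar>g\<bar> \<le> k"
      using u by (auto simp: zero_le_mult_iff)
    then show ?thesis
      using True k by (simp add: \<zeta>_def \<xi>_def)
  next
    case False
    have "\<xi> * (ua - u) \<ge> 0" "\<xi> * (ub - u) \<ge> 0"
      using vi False by (auto simp: abs_dir_deriv_def \<xi>_def \<zeta>_def algebra_simps)
    then have "\<xi> > 0 \<Longrightarrow> u = ua" "\<xi> < 0 \<Longrightarrow> u = ub"
      using u by (simp_all add: zero_le_mult_iff)
    moreover have "\<bar>\<zeta>\<bar> \<le> 1"
      using False by (simp add: \<zeta>_def sgn_if)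
    ultimately show ?thesis by blast
  qed
  then show "\<bar>\<zeta>\<bar> \<le> 1" by simp
  show "\<xi> * (v - u) \<ge> 0" if "ua \<le> v" "v \<le> ub"
    using * that by (cases \<xi> "0::real" rule: linorder_cases) (auto simp: zero_le_mult_iff)
  show "max \<xi> 0 * (u - ua) = 0" "max (- \<xi>) 0 * (ub - u) = 0"
    using * by (auto simp: max_def)
qed


section \<open>Convexity of the control set and integral estimates along a line\<close>

lemma admissible_controls_convex:
  assumes u: "u \<in> admissible_controls \<Omega> u\<^sub>a u\<^sub>b" and v: "v \<in> admissible_controls \<Omega> u\<^sub>a u\<^sub>b"
    and t: "0 \<le> t" "t \<le> 1"
  shows "(\<lambda>x. u x + t * (v x - u x)) \<in> admissible_controls \<Omega> u\<^sub>a u\<^sub>b"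
proof -
  have "AE x in lebesgue_on \<Omega>. (u\<^sub>a x \<le> u x \<and> u x \<le> u\<^sub>b x) \<and> (u\<^sub>a x \<le> v x \<and> v x \<le> u\<^sub>b x)"
    using u v by (intro AE_conjI) (auto simp: admissible_controls_def)
  then have "AE x in lebesgue_on \<Omega>. u\<^sub>a x \<le> u x + t * (v x - u x) \<and> u x + t * (v x - u x) \<le> u\<^sub>b x"
  proof eventually_elim
    case (elim x)
    have "u x + t * (v x - u x) = (1 - t) * u x + t * v x"
      by (simp add: algebra_simps)
    \<comment> \<open>\<open>convex_bound_le\<close> bounds convex combinations from above; the
      lower bound is its instance for the negated functions.\<close>
    then show ?case
      using elim t convex_bound_le[of "u x" "u\<^sub>b x" "v x" "1 - t" t]
        convex_bound_le[of "- u x" "- u\<^sub>a x" "- v x" "1 - t" t] by simp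
  qed
  moreover have "(\<lambda>x. u x + t * (v x - u x)) \<in> L2_space \<Omega>"
    using u v by (intro L2_add L2_cmult L2_diff) (auto simp: admissible_controls_def)
  ultimately show ?thesis
    by (simp add: admissible_controls_def)
qed

lemma integrable_h_reg_root:
  assumes "p > 1" "\<gamma> > 0" "finite_measure (lebesgue_on \<Omega>)" "u \<in> L2_space \<Omega>"
  shows "integrable (lebesgue_on \<Omega>) (\<lambda>x. h_reg p \<gamma> (u x) powr (1 / p))"
proof (rule Bochner_Integration.integrable_bound)
  show "integrable (lebesgue_on \<Omega>) (\<lambda>x. delta_reg p \<gamma> * \<bar>u x\<bar>)"
    using L2_integrable[OF assms(3,4)] by simp
  show "(\<lambda>x. h_reg p \<gamma> (u x) powr (1 / p)) \<in> borel_measurable (lebesgue_on \<Omega>)"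
    using L2_spaceD(1)[OF assms(4)] by measurable
  show "AE x in lebesgue_on \<Omega>. norm (h_reg p \<gamma> (u x) powr (1 / p)) \<le> norm (delta_reg p \<gamma> * \<bar>u x\<bar>)"
    using h_reg_root_le[OF assms(1,2)] delta_reg_pos[OF assms(1,2)]
    by (intro AE_I2) (simp add: abs_mult)
qed

lemma w_reg_L2:
  assumes "p > 1" "\<gamma> > 0" "finite_measure (lebesgue_on \<Omega>)" "u \<in> L2_space \<Omega>"
  shows "(\<lambda>x. w_reg p \<gamma> (u x)) \<in> L2_space \<Omega>"
  using L2_spaceD(1)[OF assms(4)] abs_w_reg_le[OF assms(1,2)]
  by (intro Linf_space_subset_L2[OF assms(3)]) (auto simp: Linf_space_def)

lemma integrable_abs_dir_deriv:
  assumes "finite_measure (lebesgue_on \<Omega>)" "u \<in> L2_space \<Omega>" "d \<in> L2_space \<Omega>"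
  shows "integrable (lebesgue_on \<Omega>) (\<lambda>x. abs_dir_deriv (u x) (d x))"
proof (rule Bochner_Integration.integrable_bound)
  show "integrable (lebesgue_on \<Omega>) (\<lambda>x. \<bar>d x\<bar>)"
    using L2_integrable[OF assms(1,3)] by simp
  show "(\<lambda>x. abs_dir_deriv (u x) (d x)) \<in> borel_measurable (lebesgue_on \<Omega>)"
    using L2_spaceD(1)[OF assms(2)] L2_spaceD(1)[OF assms(3)] by measurable
  show "AE x in lebesgue_on \<Omega>. norm (abs_dir_deriv (u x) (d x)) \<le> norm \<bar>d x\<bar>"
    by (simp add: abs_abs_dir_deriv_le)
qed

text \<open>The pointwise estimate \<open>h_reg_root_diff_le\<close> at \<open>u x\<close> and
  \<open>u x + t * d x\<close>, integrated. The difference quotient of the absolute value stays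
  under the integral, ready for dominated convergence.\<close>

lemma Upsilon_quotient_le:
  assumes p: "p > 1" and g: "\<gamma> > 0" and fin: "finite_measure (lebesgue_on \<Omega>)"
    and u: "u \<in> L2_space \<Omega>" and d: "d \<in> L2_space \<Omega>" and t: "t > 0"
  shows "Upsilon \<Omega> p \<gamma> (\<lambda>x. u x + t * d x) - Upsilon \<Omega> p \<gamma> u
    \<le> t * (delta_reg p \<gamma> * (LINT x|lebesgue_on \<Omega>. inverse t * (\<bar>u x + t * d x\<bar> - \<bar>u x\<bar>))
           - L2_inner \<Omega> (\<lambda>x. w_reg p \<gamma> (u x)) d)"
proof -
  let ?M = "lebesgue_on \<Omega>"
  let ?v = "\<lambda>x. u x + t * d x"
  have v: "?v \<in> L2_space \<Omega>"
    using u d by (intro L2_add L2_cmult)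
  have abs: "integrable ?M (\<lambda>x. \<bar>?v x\<bar> - \<bar>u x\<bar>)"
    using L2_integrable[OF fin u] L2_integrable[OF fin v] by simp
  have wd: "integrable ?M (\<lambda>x. w_reg p \<gamma> (u x) * d x)"
    by (intro L2_integrable_mult w_reg_L2 p g fin u d)
  have "Upsilon \<Omega> p \<gamma> ?v - Upsilon \<Omega> p \<gamma> u
      = (LINT x|?M. h_reg p \<gamma> (?v x) powr (1 / p) - h_reg p \<gamma> (u x) powr (1 / p))"
    using integrable_h_reg_root[OF p g fin] u v by (simp add: Upsilon_def)
  also have "\<dots> \<le> (LINT x|?M. delta_reg p \<gamma> * (\<bar>?v x\<bar> - \<bar>u x\<bar>) - t * (w_reg p \<gamma> (u x) * d x))"
  proof (rule integral_mono)
    show "integrable ?M (\<lambda>x. h_reg p \<gamma> (?v x) powr (1 / p) - h_reg p \<gamma> (u x) powr (1 / p))"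
      using integrable_h_reg_root[OF p g fin] u v by (intro Bochner_Integration.integrable_diff) auto
    show "integrable ?M (\<lambda>x. delta_reg p \<gamma> * (\<bar>?v x\<bar> - \<bar>u x\<bar>) - t * (w_reg p \<gamma> (u x) * d x))"
      using abs wd by (intro Bochner_Integration.integrable_diff) auto
    show "h_reg p \<gamma> (?v x) powr (1 / p) - h_reg p \<gamma> (u x) powr (1 / p)
        \<le> delta_reg p \<gamma> * (\<bar>?v x\<bar> - \<bar>u x\<bar>) - t * (w_reg p \<gamma> (u x) * d x)" for x
      using h_reg_root_diff_le[OF p g, of "?v x" "u x"] by (simp add: algebra_simps)
  qed
  also have "\<dots> = delta_reg p \<gamma> * (LINT x|?M. \<bar>?v x\<bar> - \<bar>u x\<bar>)
      - t * L2_inner \<Omega> (\<lambda>x. w_reg p \<gamma> (u x)) d"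
    unfolding L2_inner_def using abs wd
    by (subst Bochner_Integration.integral_diff) (auto simp del: Bochner_Integration.integral_diff)
  also have "\<dots> = t * (delta_reg p \<gamma> * (LINT x|?M. inverse t * (\<bar>u x + t * d x\<bar> - \<bar>u x\<bar>))
           - L2_inner \<Omega> (\<lambda>x. w_reg p \<gamma> (u x)) d)"
    unfolding integral_mult_right_zero using t by (simp add: right_diff_distrib)
  finally show ?thesis .
qed

section \<open>Expansion of the tracking term and minimality of the cost\<close>

text \<open>Only inner products with the states are compared, so \<open>yt\<close> never has to be
  identified with \<open>y + t * z\<close>. The coefficient of the linear term becomes an inner
  product with \<open>\<phi>\<close> because the adjoint state moves the solution operator off
  \<open>d\<close>.\<close>

lemma state_tracking_expansion:
  assumes ell: "elliptic_coefficients \<Omega> a c0" and solv: "continuously_solvable \<Omega> a c0"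
    and meas: "\<Omega> \<in> sets lebesgue"
    and w: "w \<in> L2_space \<Omega>" and d: "d \<in> L2_space \<Omega>" and yd: "yd \<in> L2_space \<Omega>"
    and y: "state_equation \<Omega> a c0 y w"
    and z: "state_equation \<Omega> a c0 z d"
    and yt: "state_equation \<Omega> a c0 yt (\<lambda>x. w x + t * d x)"
    and \<phi>: "state_equation \<Omega> a c0 \<phi> (\<lambda>x. y x - yd x)"
  shows "(L2_norm \<Omega> (\<lambda>x. yt x - yd x))\<^sup>2
    = (L2_norm \<Omega> (\<lambda>x. y x - yd x))\<^sup>2 + 2 * t * L2_inner \<Omega> \<phi> d + t\<^sup>2 * L2_inner \<Omega> z z"
proof -
  note L2 = state_equation_L2[OF y] state_equation_L2[OF z] state_equation_L2[OF yt]
    state_equation_L2[OF \<phi>] w d yd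
  note lin = L2_inner_linear_left L2_inner_linear_right L2_add L2_diff L2_cmult L2
  \<comment> \<open>With \<open>s\<close> the state for \<open>v\<close>, self-adjointness turns the
    left side into the inner product of \<open>w + t * d\<close> with \<open>s\<close>, which is
    linear in the data; self-adjointness then turns each term back.\<close>
  have inner: "L2_inner \<Omega> yt v = L2_inner \<Omega> y v + t * L2_inner \<Omega> z v" if v: "v \<in> L2_space \<Omega>" for v
  proof -
    obtain s where s: "state_equation \<Omega> a c0 s v"
      using solv v by (auto simp: continuously_solvable_def)
    show ?thesis
      using state_equation_symmetric[OF ell meas _ s] y z yt state_equation_L2[OF s] by (simp add: lin)
  qed
  have adj: "L2_inner \<Omega> z y = L2_inner \<Omega> \<phi> d + L2_inner \<Omega> z yd"
    using state_equation_symmetric[OF ell meas z \<phi>] L2_inner_commute[of \<Omega> d \<phi>] by (simp add: lin)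
  \<comment> \<open>\<open>inner\<close> is used with \<open>yt\<close> itself in the second slot,
    and then with \<open>y\<close> and \<open>z\<close> to expand the two resulting
    products.\<close>
  have yt_yt: "L2_inner \<Omega> yt yt
      = L2_inner \<Omega> y y + 2 * t * L2_inner \<Omega> z y + t\<^sup>2 * L2_inner \<Omega> z z"
    using inner[OF L2(3)] inner[OF L2(1)] inner[OF L2(2)] L2_inner_commute[of \<Omega> yt y]
      L2_inner_commute[of \<Omega> yt z] L2_inner_commute[of \<Omega> y z]
    by (simp add: algebra_simps power2_eq_square)
  show ?thesis
    using inner[OF yd] yt_yt adj L2_inner_commute[of \<Omega> yt yd] L2_inner_commute[of \<Omega> y yd]
    by (simp add: L2_norm_power2 lin algebra_simps)
qed

lemma optimal_control_admissible:
  "optimal_control \<Omega> a c0 f yd \<alpha> \<beta> p \<gamma> u\<^sub>a u\<^sub>b u \<Longrightarrow> u \<in> admissible_controls \<Omega> u\<^sub>a u\<^sub>b"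
  by (auto simp: optimal_control_def is_arg_min_def feasible_pairs_def)

text \<open>Optimality of \<open>u0\<close> only provides some state \<open>y'\<close>. Uniqueness
  almost everywhere gives any other state \<open>y\<close> of \<open>u0\<close> the same tracking
  term, so minimality transfers to it.\<close>

lemma optimal_control_minimal:
  assumes solv: "continuously_solvable \<Omega> a c0"
    and f: "f \<in> L2_space \<Omega>" and yd: "yd \<in> L2_space \<Omega>"
    and opt: "optimal_control \<Omega> a c0 f yd \<alpha> \<beta> p \<gamma> u\<^sub>a u\<^sub>b u0"
    and y: "state_equation \<Omega> a c0 y (\<lambda>x. u0 x + f x)"
    and v: "v \<in> admissible_controls \<Omega> u\<^sub>a u\<^sub>b"
    and z: "state_equation \<Omega> a c0 z (\<lambda>x. v x + f x)"
  shows "cost_functional \<Omega> yd \<alpha> \<beta> p \<gamma> (y, u0) \<le> cost_functional \<Omega> yd \<alpha> \<beta> p \<gamma> (z, v)"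
proof -
  obtain y' where y': "is_arg_min (cost_functional \<Omega> yd \<alpha> \<beta> p \<gamma>)
      (\<lambda>z. z \<in> feasible_pairs \<Omega> a c0 f u\<^sub>a u\<^sub>b) (y', u0)"
    using opt by (auto simp: optimal_control_def)
  then have y'_state: "state_equation \<Omega> a c0 y' (\<lambda>x. u0 x + f x)"
    by (auto simp: is_arg_min_def feasible_pairs_def)
  have "(\<lambda>x. u0 x + f x) \<in> L2_space \<Omega>"
    using optimal_control_admissible[OF opt] f by (auto simp: admissible_controls_def intro: L2_add)
  then have "AE x in lebesgue_on \<Omega>. y x = y' x"
    using solv y y'_state by (auto simp: continuously_solvable_def)
  then have "AE x in lebesgue_on \<Omega>. (y x - yd x) * (y x - yd x) = (y' x - yd x) * (y' x - yd x)"
    by eventually_elim simp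
  moreover have [measurable]: "y \<in> borel_measurable (lebesgue_on \<Omega>)"
    "y' \<in> borel_measurable (lebesgue_on \<Omega>)" "yd \<in> borel_measurable (lebesgue_on \<Omega>)"
    using y y'_state yd by (auto dest!: state_equation_L2 L2_spaceD(1))
  ultimately have "L2_norm \<Omega> (\<lambda>x. y x - yd x) = L2_norm \<Omega> (\<lambda>x. y' x - yd x)"
    unfolding L2_norm_def L2_inner_def by (subst integral_cong_AE) auto
  moreover have "(z, v) \<in> feasible_pairs \<Omega> a c0 f u\<^sub>a u\<^sub>b"
    using v z by (simp add: feasible_pairs_def)
  ultimately show "cost_functional \<Omega> yd \<alpha> \<beta> p \<gamma> (y, u0) \<le> cost_functional \<Omega> yd \<alpha> \<beta> p \<gamma> (z, v)"
    using y' by (auto simp: is_arg_min_def cost_functional_def not_less)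
qed

section \<open>First-order conditions, integrated and pointwise\<close>

text \<open>The cost at \<open>u0\<close> is compared with the cost at \<open>u0 + t n * d\<close>.
  After division by \<open>t n\<close> the quadratic terms keep a factor \<open>t n\<close> and
  disappear in the limit, while the nonsmooth term converges to the integrated directional
  derivative.\<close>

lemma first_order_condition:
  assumes ell: "elliptic_coefficients \<Omega> a c0" and solv: "continuously_solvable \<Omega> a c0"
    and meas: "\<Omega> \<in> sets lebesgue" and fin: "finite_measure (lebesgue_on \<Omega>)"
    and p: "p > 1" and g: "\<gamma> > 0" and \<beta>: "\<beta> > 0"
    and f: "f \<in> L2_space \<Omega>" and yd: "yd \<in> L2_space \<Omega>"
    and opt: "optimal_control \<Omega> a c0 f yd \<alpha> \<beta> p \<gamma> u\<^sub>a u\<^sub>b u0"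
    and y: "state_equation \<Omega> a c0 y (\<lambda>x. u0 x + f x)"
    and \<phi>: "state_equation \<Omega> a c0 \<phi> (\<lambda>x. y x - yd x)"
    and u: "u \<in> admissible_controls \<Omega> u\<^sub>a u\<^sub>b"
  shows "integrable (lebesgue_on \<Omega>) (\<lambda>x. (\<phi> x + \<alpha> * u0 x - \<beta> * w_reg p \<gamma> (u0 x)) * (u x - u0 x)
      + \<beta> * delta_reg p \<gamma> * abs_dir_deriv (u0 x) (u x - u0 x))"
    and "0 \<le> (LINT x|lebesgue_on \<Omega>. (\<phi> x + \<alpha> * u0 x - \<beta> * w_reg p \<gamma> (u0 x)) * (u x - u0 x)
      + \<beta> * delta_reg p \<gamma> * abs_dir_deriv (u0 x) (u x - u0 x))"
proof -
  let ?M = "lebesgue_on \<Omega>"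
  let ?w = "\<lambda>x. w_reg p \<gamma> (u0 x)"
  define d where "d x = u x - u0 x" for x
  have u0_adm: "u0 \<in> admissible_controls \<Omega> u\<^sub>a u\<^sub>b"
    by (rule optimal_control_admissible[OF opt])
  have u0: "u0 \<in> L2_space \<Omega>" and d: "d \<in> L2_space \<Omega>"
    using u0_adm u by (auto simp: admissible_controls_def d_def[abs_def] intro: L2_diff)
  have w: "?w \<in> L2_space \<Omega>"
    by (intro w_reg_L2 p g fin u0)
  have \<phi>_L2: "\<phi> \<in> L2_space \<Omega>"
    by (rule state_equation_L2[OF \<phi>])
  have r: "(\<lambda>x. u0 x + f x) \<in> L2_space \<Omega>"
    using u0 f by (rule L2_add)
  have grad: "(\<lambda>x. \<phi> x + \<alpha> * u0 x - \<beta> * ?w x) \<in> L2_space \<Omega>"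
    by (intro L2_diff L2_add L2_cmult \<phi>_L2 u0 w)
  have ad: "integrable ?M (\<lambda>x. abs_dir_deriv (u0 x) (d x))"
    by (intro integrable_abs_dir_deriv fin u0 d)
  show "integrable ?M (\<lambda>x. (\<phi> x + \<alpha> * u0 x - \<beta> * ?w x) * (u x - u0 x)
      + \<beta> * delta_reg p \<gamma> * abs_dir_deriv (u0 x) (u x - u0 x))"
    using L2_integrable_mult[OF grad d] ad unfolding d_def
    by (intro Bochner_Integration.integrable_add integrable_mult_right) auto
  obtain z where z: "state_equation \<Omega> a c0 z d"
    using solv d by (auto simp: continuously_solvable_def)
  \<comment> \<open>Starting at \<open>1 / (0 + 1)\<close> keeps every step in the interval from
    \<open>0\<close> to \<open>1\<close>, so the perturbed controls are convex combinations of
    admissible ones.\<close>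
  define t where "t n = inverse (real (Suc n))" for n
  define Q where "Q n = (LINT x|?M. inverse (t n) * (\<bar>u0 x + t n * d x\<bar> - \<bar>u0 x\<bar>))" for n
  \<comment> \<open>\<open>t n * bound n\<close> is an upper bound for the increase of the cost: the
    tracking and control terms are expanded exactly, only the \<open>Upsilon\<close> term is
    estimated.\<close>
  define bound where "bound n = L2_inner \<Omega> \<phi> d + \<alpha> * L2_inner \<Omega> u0 d
      + t n * (L2_inner \<Omega> z z / 2 + \<alpha> / 2 * L2_inner \<Omega> d d)
      + \<beta> * (delta_reg p \<gamma> * Q n - L2_inner \<Omega> ?w d)" for n
  have "0 \<le> bound n" for n
  proof -
    have t: "0 < t n" "t n \<le> 1"
      by (auto simp: t_def field_simps)
    let ?ut = "\<lambda>x. u0 x + t n * d x"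
    have ut_adm: "?ut \<in> admissible_controls \<Omega> u\<^sub>a u\<^sub>b"
      unfolding d_def using t by (intro admissible_controls_convex u0_adm u) auto
    have "(\<lambda>x. (u0 x + f x) + t n * d x) \<in> L2_space \<Omega>"
      by (intro L2_add L2_cmult u0 f d)
    then obtain yt where yt: "state_equation \<Omega> a c0 yt (\<lambda>x. (u0 x + f x) + t n * d x)"
      using solv by (auto simp: continuously_solvable_def)
    then have "state_equation \<Omega> a c0 yt (\<lambda>x. ?ut x + f x)"
      by (simp add: algebra_simps)
    from optimal_control_minimal[OF solv f yd opt y ut_adm this]
    have min: "cost_functional \<Omega> yd \<alpha> \<beta> p \<gamma> (y, u0) \<le> cost_functional \<Omega> yd \<alpha> \<beta> p \<gamma> (yt, ?ut)" .
    have track: "(L2_norm \<Omega> (\<lambda>x. yt x - yd x))\<^sup>2 = (L2_norm \<Omega> (\<lambda>x. y x - yd x))\<^sup>2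
        + 2 * t n * L2_inner \<Omega> \<phi> d + (t n)\<^sup>2 * L2_inner \<Omega> z z"
      by (rule state_tracking_expansion[OF ell solv meas r d yd y z yt \<phi>])
    have control: "(L2_norm \<Omega> ?ut)\<^sup>2
        = (L2_norm \<Omega> u0)\<^sup>2 + 2 * t n * L2_inner \<Omega> u0 d + (t n)\<^sup>2 * L2_inner \<Omega> d d"
    proof -
      have "L2_inner \<Omega> ?ut ?ut = L2_inner \<Omega> u0 u0 + t n * L2_inner \<Omega> u0 d
          + t n * (L2_inner \<Omega> d u0 + t n * L2_inner \<Omega> d d)"
        using u0 d by (simp add: L2_inner_linear_left L2_inner_linear_right L2_add L2_cmult)
      then show ?thesis
        unfolding L2_norm_power2 L2_inner_commute[of \<Omega> d u0]
        by (simp add: algebra_simps power2_eq_square)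
    qed
    have ups: "\<beta> * (Upsilon \<Omega> p \<gamma> ?ut - Upsilon \<Omega> p \<gamma> u0)
        \<le> \<beta> * (t n * (delta_reg p \<gamma> * Q n - L2_inner \<Omega> ?w d))"
      unfolding Q_def using \<beta> t by (intro mult_left_mono Upsilon_quotient_le p g fin u0 d) auto
    have "t n * bound n = 1 / 2 * (2 * t n * L2_inner \<Omega> \<phi> d + (t n)\<^sup>2 * L2_inner \<Omega> z z)
        + \<alpha> / 2 * (2 * t n * L2_inner \<Omega> u0 d + (t n)\<^sup>2 * L2_inner \<Omega> d d)
        + \<beta> * (t n * (delta_reg p \<gamma> * Q n - L2_inner \<Omega> ?w d))"
      by (simp add: bound_def algebra_simps power2_eq_square)
    also have "\<dots> \<ge> cost_functional \<Omega> yd \<alpha> \<beta> p \<gamma> (yt, ?ut) - cost_functional \<Omega> yd \<alpha> \<beta> p \<gamma> (y, u0)"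
      using ups by (simp only: cost_functional_def prod.case track control distrib_left right_diff_distrib)
    finally have "0 \<le> t n * bound n"
      using min by linarith
    then show ?thesis
      using t by (simp add: zero_le_mult_iff)
  qed
  moreover have "bound \<longlonglongrightarrow> L2_inner \<Omega> \<phi> d + \<alpha> * L2_inner \<Omega> u0 d
      + 0 * (L2_inner \<Omega> z z / 2 + \<alpha> / 2 * L2_inner \<Omega> d d)
      + \<beta> * (delta_reg p \<gamma> * (LINT x|?M. abs_dir_deriv (u0 x) (d x)) - L2_inner \<Omega> ?w d)"
  proof -
    \<comment> \<open>Dominated convergence with majorant \<open>\<bar>d x\<bar>\<close>, integrable
      because the domain has finite measure.\<close>
    have "Q \<longlonglongrightarrow> (LINT x|?M. abs_dir_deriv (u0 x) (d x))"
      unfolding Q_def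
    proof (rule integral_dominated_convergence)
      show "(\<lambda>x. abs_dir_deriv (u0 x) (d x)) \<in> borel_measurable ?M"
        using ad by auto
      show "(\<lambda>x. inverse (t n) * (\<bar>u0 x + t n * d x\<bar> - \<bar>u0 x\<bar>)) \<in> borel_measurable ?M" for n
        using L2_spaceD(1)[OF u0] L2_spaceD(1)[OF d] by measurable
      show "integrable ?M (\<lambda>x. \<bar>d x\<bar>)"
        using L2_integrable[OF fin d] by simp
      show "AE x in ?M. (\<lambda>n. inverse (t n) * (\<bar>u0 x + t n * d x\<bar> - \<bar>u0 x\<bar>)) \<longlonglongrightarrow> abs_dir_deriv (u0 x) (d x)"
        unfolding t_def inverse_inverse_eq using abs_dir_deriv_tendsto by simp
      show "AE x in ?M. norm (inverse (t n) * (\<bar>u0 x + t n * d x\<bar> - \<bar>u0 x\<bar>)) \<le> \<bar>d x\<bar>" for n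
        unfolding t_def inverse_inverse_eq real_norm_def using abs_diff_quotient_le by simp
    qed
    moreover have "t \<longlonglongrightarrow> 0"
      unfolding t_def by (rule LIMSEQ_inverse_real_of_nat)
    ultimately show ?thesis
      unfolding bound_def by (intro tendsto_intros)
  qed
  ultimately have limit_nonneg: "0 \<le> L2_inner \<Omega> \<phi> d + \<alpha> * L2_inner \<Omega> u0 d
      + \<beta> * (delta_reg p \<gamma> * (LINT x|?M. abs_dir_deriv (u0 x) (d x)) - L2_inner \<Omega> ?w d)"
    by (intro LIMSEQ_le_const[of bound]) auto
  have "L2_inner \<Omega> (\<lambda>x. \<phi> x + \<alpha> * u0 x - \<beta> * ?w x) d
      = L2_inner \<Omega> \<phi> d + \<alpha> * L2_inner \<Omega> u0 d - \<beta> * L2_inner \<Omega> ?w d"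
    using \<phi>_L2 u0 w d by (simp add: L2_inner_linear_left L2_add L2_cmult)
  with limit_nonneg have "0 \<le> L2_inner \<Omega> (\<lambda>x. \<phi> x + \<alpha> * u0 x - \<beta> * ?w x) d
      + (LINT x|?M. \<beta> * delta_reg p \<gamma> * abs_dir_deriv (u0 x) (d x))"
    by (simp add: right_diff_distrib mult.assoc)
  also have "\<dots> = (LINT x|?M. (\<phi> x + \<alpha> * u0 x - \<beta> * ?w x) * d x
      + \<beta> * delta_reg p \<gamma> * abs_dir_deriv (u0 x) (d x))"
    unfolding L2_inner_def using L2_integrable_mult[OF grad d] ad
    by (intro Bochner_Integration.integral_add[symmetric] integrable_mult_right) auto
  finally show "0 \<le> (LINT x|?M. (\<phi> x + \<alpha> * u0 x - \<beta> * ?w x) * (u x - u0 x)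
      + \<beta> * delta_reg p \<gamma> * abs_dir_deriv (u0 x) (u x - u0 x))"
    by (simp add: d_def)
qed

text \<open>Replacing \<open>u0\<close> by \<open>u\<close> on an arbitrary measurable set
  \<open>A\<close> only is again admissible, so the integrated condition holds over every such
  set.\<close>

lemma first_order_condition_AE:
  assumes ell: "elliptic_coefficients \<Omega> a c0" and solv: "continuously_solvable \<Omega> a c0"
    and meas: "\<Omega> \<in> sets lebesgue" and fin: "finite_measure (lebesgue_on \<Omega>)"
    and p: "p > 1" and g: "\<gamma> > 0" and \<beta>: "\<beta> > 0"
    and f: "f \<in> L2_space \<Omega>" and yd: "yd \<in> L2_space \<Omega>"
    and opt: "optimal_control \<Omega> a c0 f yd \<alpha> \<beta> p \<gamma> u\<^sub>a u\<^sub>b u0"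
    and y: "state_equation \<Omega> a c0 y (\<lambda>x. u0 x + f x)"
    and \<phi>: "state_equation \<Omega> a c0 \<phi> (\<lambda>x. y x - yd x)"
    and u: "u \<in> admissible_controls \<Omega> u\<^sub>a u\<^sub>b"
  shows "AE x in lebesgue_on \<Omega>. 0 \<le> (\<phi> x + \<alpha> * u0 x - \<beta> * w_reg p \<gamma> (u0 x)) * (u x - u0 x)
      + \<beta> * delta_reg p \<gamma> * abs_dir_deriv (u0 x) (u x - u0 x)"
proof (rule AE_nonneg_if_integral_over_sets_nonneg)
  note foc = first_order_condition[OF ell solv meas fin p g \<beta> f yd opt y \<phi>]
  have u0: "u0 \<in> admissible_controls \<Omega> u\<^sub>a u\<^sub>b"
    by (rule optimal_control_admissible[OF opt])
  show "integrable (lebesgue_on \<Omega>) (\<lambda>x. (\<phi> x + \<alpha> * u0 x - \<beta> * w_reg p \<gamma> (u0 x)) * (u x - u0 x)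
      + \<beta> * delta_reg p \<gamma> * abs_dir_deriv (u0 x) (u x - u0 x))"
    by (rule foc(1)[OF u])
  fix A assume A: "A \<in> sets (lebesgue_on \<Omega>)"
  define v where "v x = u0 x + indicator A x * (u x - u0 x)" for x
  have d: "(\<lambda>x. u x - u0 x) \<in> L2_space \<Omega>" and u0_L2: "u0 \<in> L2_space \<Omega>"
    using u u0 by (auto simp: admissible_controls_def intro: L2_diff)
  have "(\<lambda>x. indicator A x * (u x - u0 x)) \<in> L2_space \<Omega>"
  proof -
    have "(\<lambda>x. indicator A x * (u x - u0 x)) \<in> borel_measurable (lebesgue_on \<Omega>)"
      using A L2_spaceD(1)[OF d] by measurable
    moreover have "(\<lambda>x. (indicator A x * (u x - u0 x))\<^sup>2) = (\<lambda>x. indicator A x *\<^sub>R (u x - u0 x)\<^sup>2)"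
      by (auto simp: indicator_def)
    ultimately show ?thesis
      using integrable_mult_indicator[OF A L2_spaceD(2)[OF d]] by (simp add: L2_space_def)
  qed
  then have "v \<in> L2_space \<Omega>"
    unfolding v_def using u0_L2 by (intro L2_add)
  moreover have "AE x in lebesgue_on \<Omega>. u\<^sub>a x \<le> v x \<and> v x \<le> u\<^sub>b x"
  proof -
    have "AE x in lebesgue_on \<Omega>. (u\<^sub>a x \<le> u x \<and> u x \<le> u\<^sub>b x) \<and> (u\<^sub>a x \<le> u0 x \<and> u0 x \<le> u\<^sub>b x)"
      using u u0 by (intro AE_conjI) (auto simp: admissible_controls_def)
    then show ?thesis
      by eventually_elim (auto simp: v_def indicator_def)
  qed
  ultimately have "v \<in> admissible_controls \<Omega> u\<^sub>a u\<^sub>b"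
    by (simp add: admissible_controls_def)
  from foc(2)[OF this]
  show "0 \<le> (LINT x|lebesgue_on \<Omega>. indicator A x *
      ((\<phi> x + \<alpha> * u0 x - \<beta> * w_reg p \<gamma> (u0 x)) * (u x - u0 x)
      + \<beta> * delta_reg p \<gamma> * abs_dir_deriv (u0 x) (u x - u0 x)))"
    \<comment> \<open>Off \<open>A\<close> the direction \<open>v x - u0 x\<close> is
      \<open>0\<close>, and the directional derivative in direction \<open>0\<close> vanishes, so
      restricting the direction restricts the whole integrand.\<close>
    by (rule ord_le_eq_trans)
      (intro Bochner_Integration.integral_cong refl, auto simp: v_def indicator_def abs_dir_deriv_def)
qed

section \<open>Assembly of the optimality system and the KKT system\<close>

theorem theorem6:
  fixes \<Omega> :: "(real ^ 'n) set"
    and a :: "'n \<Rightarrow> 'n \<Rightarrow> real ^ 'n \<Rightarrow> real"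
    and c0 f y\<^sub>d u\<^sub>a u\<^sub>b u\<^sub>0 :: "real ^ 'n \<Rightarrow> real"
    and p \<alpha> \<beta> \<gamma> :: real
  assumes "CARD('n) = 2 \<or> CARD('n) = 3"
    and "bounded_lipschitz_domain \<Omega>"
    and "p > 1" and "\<alpha> > 0" and "\<beta> > 0" and "\<gamma> > 0"
    and "f \<in> L2_space \<Omega>" and "y\<^sub>d \<in> L2_space \<Omega>"
    and "elliptic_coefficients \<Omega> a c0"
    and "continuously_solvable \<Omega> a c0"
    and "u\<^sub>a \<in> Linf_space \<Omega>" and "u\<^sub>b \<in> Linf_space \<Omega>"
    and "AE x in lebesgue_on \<Omega>. u\<^sub>a x < 0 \<and> 0 < u\<^sub>b x"
    and "optimal_control \<Omega> a c0 f y\<^sub>d \<alpha> \<beta> p \<gamma> u\<^sub>a u\<^sub>b u\<^sub>0"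
  shows "\<exists>y \<phi> \<zeta> w.
     y = solution_operator \<Omega> a c0 (\<lambda>x. u\<^sub>0 x + f x) \<and>
     y \<in> H10_space \<Omega> \<and> \<phi> \<in> H10_space \<Omega> \<and> \<zeta> \<in> L2_space \<Omega> \<and>
     w = (\<lambda>x. if \<bar>u\<^sub>0 x\<bar> > 1 / \<gamma>
              then (delta_reg p \<gamma>
                    - 1 / p * (\<bar>u\<^sub>0 x\<bar> + 1 / \<gamma> * ((1 - p) / p)) powr ((1 - p) / p)) * sgn (u\<^sub>0 x)
              else 0) \<and>
     state_equation \<Omega> a c0 y (\<lambda>x. u\<^sub>0 x + f x) \<and>
     adjoint_equation \<Omega> a c0 \<phi> (\<lambda>x. y x - y\<^sub>d x) \<and>
     (\<forall>u \<in> admissible_controls \<Omega> u\<^sub>a u\<^sub>b.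
        L2_inner \<Omega> (\<lambda>x. \<phi> x + \<alpha> * u\<^sub>0 x + \<beta> * (delta_reg p \<gamma> * \<zeta> x - w x))
                   (\<lambda>x. u x - u\<^sub>0 x) \<ge> 0) \<and>
     (AE x in lebesgue_on \<Omega>. (u\<^sub>0 x > 0 \<longrightarrow> \<zeta> x = 1) \<and> (u\<^sub>0 x < 0 \<longrightarrow> \<zeta> x = - 1) \<and>
                              (u\<^sub>0 x = 0 \<longrightarrow> \<bar>\<zeta> x\<bar> \<le> 1)) \<and>
     (\<exists>\<mu>\<^sub>a \<in> L2_space \<Omega>. \<exists>\<mu>\<^sub>b \<in> L2_space \<Omega>. AE x in lebesgue_on \<Omega>.
        \<phi> x + \<alpha> * u\<^sub>0 x + \<beta> * (delta_reg p \<gamma> * \<zeta> x - w x) + \<mu>\<^sub>b x - \<mu>\<^sub>a x = 0 \<and>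
        \<mu>\<^sub>a x \<ge> 0 \<and> \<mu>\<^sub>b x \<ge> 0 \<and>
        \<mu>\<^sub>a x * (u\<^sub>0 x - u\<^sub>a x) = 0 \<and> \<mu>\<^sub>b x * (u\<^sub>b x - u\<^sub>0 x) = 0)"
proof -
  note ell = assms(9) and solv = assms(10) and p = assms(3) and g = assms(6) and \<beta> = assms(5)
    and f = assms(7) and yd = assms(8) and opt = assms(14) and ua_ub = assms(13)
  have lm: "\<Omega> \<in> lmeasurable"
    using assms(2) by (auto simp: bounded_lipschitz_domain_def intro: lmeasurable_open)
  then have meas: "\<Omega> \<in> sets lebesgue" and fin: "finite_measure (lebesgue_on \<Omega>)"
    by (auto simp: fmeasurableD finite_measure_lebesgue_on)
  have u0: "u\<^sub>0 \<in> admissible_controls \<Omega> u\<^sub>a u\<^sub>b"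
    by (rule optimal_control_admissible[OF opt])
  have u0_L2: "u\<^sub>0 \<in> L2_space \<Omega>"
    using u0 by (simp add: admissible_controls_def)
  define y where "y = solution_operator \<Omega> a c0 (\<lambda>x. u\<^sub>0 x + f x)"
  have "\<exists>y. state_equation \<Omega> a c0 y (\<lambda>x. u\<^sub>0 x + f x)"
    using solv L2_add[OF u0_L2 f] by (simp add: continuously_solvable_def)
  then have y: "state_equation \<Omega> a c0 y (\<lambda>x. u\<^sub>0 x + f x)"
    unfolding y_def solution_operator_def by (rule someI_ex)
  obtain \<phi> where \<phi>: "state_equation \<Omega> a c0 \<phi> (\<lambda>x. y x - y\<^sub>d x)"
    using solv L2_diff[OF state_equation_L2[OF y] yd] by (auto simp: continuously_solvable_def)
  have adjoint: "adjoint_equation \<Omega> a c0 \<phi> (\<lambda>x. y x - y\<^sub>d x)"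
    using \<phi> bilinear_form_commute[OF ell meas] by (simp add: state_equation_def adjoint_equation_def)
  define k where "k = \<beta> * delta_reg p \<gamma>"
  define w where "w x = w_reg p \<gamma> (u\<^sub>0 x)" for x
  define G where "G x = \<phi> x + \<alpha> * u\<^sub>0 x - \<beta> * w x" for x
  define \<zeta> where "\<zeta> x = (if u\<^sub>0 x = 0 then - G x / k else sgn (u\<^sub>0 x))" for x
  \<comment> \<open>\<open>\<xi>\<close> is the function in the variational inequality. Its positive
    part will be the multiplier for \<open>u\<^sub>a\<close>, its negative part the one for
    \<open>u\<^sub>b\<close>.\<close>
  define \<xi> where "\<xi> x = G x + k * \<zeta> x" for x
  have k: "k > 0"
    using \<beta> delta_reg_pos[OF p g] by (simp add: k_def)
  have \<xi>_eq: "\<xi> = (\<lambda>x. \<phi> x + \<alpha> * u\<^sub>0 x + \<beta> * (delta_reg p \<gamma> * \<zeta> x - w x))"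
    by (auto simp: \<xi>_def G_def k_def algebra_simps)
  \<comment> \<open>Essential boundedness on a set of finite measure puts both bounds in $L^2$, so
    they are legitimate test controls.\<close>
  have ua: "u\<^sub>a \<in> admissible_controls \<Omega> u\<^sub>a u\<^sub>b" and ub: "u\<^sub>b \<in> admissible_controls \<Omega> u\<^sub>a u\<^sub>b"
  proof -
    have "AE x in lebesgue_on \<Omega>. u\<^sub>a x \<le> u\<^sub>b x"
      using ua_ub by eventually_elim simp
    then show "u\<^sub>a \<in> admissible_controls \<Omega> u\<^sub>a u\<^sub>b" "u\<^sub>b \<in> admissible_controls \<Omega> u\<^sub>a u\<^sub>b"
      using Linf_space_subset_L2[OF fin] assms(11,12) by (auto simp: admissible_controls_def)
  qed
  note foc = first_order_condition_AE[OF ell solv meas fin p g \<beta> f yd opt y \<phi>]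
  have "AE x in lebesgue_on \<Omega>. (u\<^sub>a x < 0 \<and> 0 < u\<^sub>b x) \<and> (u\<^sub>a x \<le> u\<^sub>0 x \<and> u\<^sub>0 x \<le> u\<^sub>b x)
      \<and> 0 \<le> G x * (u\<^sub>a x - u\<^sub>0 x) + k * abs_dir_deriv (u\<^sub>0 x) (u\<^sub>a x - u\<^sub>0 x)
      \<and> 0 \<le> G x * (u\<^sub>b x - u\<^sub>0 x) + k * abs_dir_deriv (u\<^sub>0 x) (u\<^sub>b x - u\<^sub>0 x)"
    unfolding G_def k_def w_def using ua_ub foc[OF ua] foc[OF ub] u0
    by (intro AE_conjI) (auto simp: admissible_controls_def)
  \<comment> \<open>The quantifier over the real number \<open>v\<close> stands inside
    \<open>AE\<close>: one exceptional set serves all admissible controls at once.\<close>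
  then have kkt: "AE x in lebesgue_on \<Omega>. \<bar>\<zeta> x\<bar> \<le> 1 \<and> max (\<xi> x) 0 * (u\<^sub>0 x - u\<^sub>a x) = 0
      \<and> max (- \<xi> x) 0 * (u\<^sub>b x - u\<^sub>0 x) = 0
      \<and> (\<forall>v. u\<^sub>a x \<le> v \<longrightarrow> v \<le> u\<^sub>b x \<longrightarrow> 0 \<le> \<xi> x * (v - u\<^sub>0 x))"
  proof eventually_elim
    case (elim x)
    then show ?case
      unfolding \<xi>_def \<zeta>_def using pointwise_multipliers[of k "u\<^sub>a x" "u\<^sub>b x" "u\<^sub>0 x" "G x"] k by blast
  qed
  have w: "w \<in> L2_space \<Omega>"
    unfolding w_def by (intro w_reg_L2 p g fin u0_L2)
  have G: "G \<in> L2_space \<Omega>"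
    unfolding G_def by (intro L2_diff L2_add L2_cmult u0_L2 w state_equation_L2[OF \<phi>])
  have \<zeta>: "\<zeta> \<in> L2_space \<Omega>"
  proof (rule Linf_space_subset_L2[OF fin])
    have "\<zeta> \<in> borel_measurable (lebesgue_on \<Omega>)"
      unfolding \<zeta>_def using L2_spaceD(1)[OF u0_L2] L2_spaceD(1)[OF G] by measurable
    moreover have "AE x in lebesgue_on \<Omega>. \<bar>\<zeta> x\<bar> \<le> 1"
      using kkt by eventually_elim simp
    ultimately show "\<zeta> \<in> Linf_space \<Omega>"
      by (auto simp: Linf_space_def)
  qed
  have \<xi>: "\<xi> \<in> L2_space \<Omega>"
    unfolding \<xi>_def by (intro L2_add L2_cmult G \<zeta>)
  have vi: "0 \<le> L2_inner \<Omega> \<xi> (\<lambda>x. u x - u\<^sub>0 x)" if "u \<in> admissible_controls \<Omega> u\<^sub>a u\<^sub>b" for u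
  proof -
    have "AE x in lebesgue_on \<Omega>. u\<^sub>a x \<le> u x \<and> u x \<le> u\<^sub>b x"
      using that by (simp add: admissible_controls_def)
    with kkt have "AE x in lebesgue_on \<Omega>. 0 \<le> \<xi> x * (u x - u\<^sub>0 x)"
      by eventually_elim blast
    then show ?thesis
      unfolding L2_inner_def by (rule integral_nonneg_AE)
  qed
  have pos_part: "(\<lambda>x. max (v x) 0) \<in> L2_space \<Omega>" if "v \<in> L2_space \<Omega>" for v
  proof -
    have [measurable]: "v \<in> borel_measurable (lebesgue_on \<Omega>)"
      by (rule L2_spaceD(1)[OF that])
    have "integrable (lebesgue_on \<Omega>) (\<lambda>x. (max (v x) 0)\<^sup>2)"
      by (rule Bochner_Integration.integrable_bound[OF L2_spaceD(2)[OF that]])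
        (auto simp: max_def)
    then show ?thesis
      by (simp add: L2_space_def)
  qed
  have neg_\<xi>: "(\<lambda>x. - \<xi> x) \<in> L2_space \<Omega>"
    using L2_cmult[OF \<xi>, of "- 1"] by simp
  show ?thesis
  proof (intro exI conjI)
    show "y = solution_operator \<Omega> a c0 (\<lambda>x. u\<^sub>0 x + f x)" by (rule y_def)
    show "y \<in> H10_space \<Omega>" "\<phi> \<in> H10_space \<Omega>"
      using y \<phi> by (auto simp: state_equation_def)
    show "\<zeta> \<in> L2_space \<Omega>" by (rule \<zeta>)
    show "w = (\<lambda>x. if \<bar>u\<^sub>0 x\<bar> > 1 / \<gamma>
              then (delta_reg p \<gamma>
                    - 1 / p * (\<bar>u\<^sub>0 x\<bar> + 1 / \<gamma> * ((1 - p) / p)) powr ((1 - p) / p)) * sgn (u\<^sub>0 x)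
              else 0)"
      by (rule ext) (simp only: w_def w_reg_def)
    show "state_equation \<Omega> a c0 y (\<lambda>x. u\<^sub>0 x + f x)" by (rule y)
    show "adjoint_equation \<Omega> a c0 \<phi> (\<lambda>x. y x - y\<^sub>d x)" by (rule adjoint)
    show "\<forall>u \<in> admissible_controls \<Omega> u\<^sub>a u\<^sub>b.
        L2_inner \<Omega> (\<lambda>x. \<phi> x + \<alpha> * u\<^sub>0 x + \<beta> * (delta_reg p \<gamma> * \<zeta> x - w x))
                   (\<lambda>x. u x - u\<^sub>0 x) \<ge> 0"
      using vi unfolding \<xi>_eq by blast
    show "AE x in lebesgue_on \<Omega>. (u\<^sub>0 x > 0 \<longrightarrow> \<zeta> x = 1) \<and> (u\<^sub>0 x < 0 \<longrightarrow> \<zeta> x = - 1) \<and>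
                              (u\<^sub>0 x = 0 \<longrightarrow> \<bar>\<zeta> x\<bar> \<le> 1)"
    proof -
      have sgn: "(u\<^sub>0 x > 0 \<longrightarrow> \<zeta> x = 1) \<and> (u\<^sub>0 x < 0 \<longrightarrow> \<zeta> x = - 1)" for x
        by (simp add: \<zeta>_def)
      from kkt show ?thesis
        by eventually_elim (use sgn in blast)
    qed
    show "\<exists>\<mu>\<^sub>a \<in> L2_space \<Omega>. \<exists>\<mu>\<^sub>b \<in> L2_space \<Omega>. AE x in lebesgue_on \<Omega>.
        \<phi> x + \<alpha> * u\<^sub>0 x + \<beta> * (delta_reg p \<gamma> * \<zeta> x - w x) + \<mu>\<^sub>b x - \<mu>\<^sub>a x = 0 \<and>
        \<mu>\<^sub>a x \<ge> 0 \<and> \<mu>\<^sub>b x \<ge> 0 \<and>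
        \<mu>\<^sub>a x * (u\<^sub>0 x - u\<^sub>a x) = 0 \<and> \<mu>\<^sub>b x * (u\<^sub>b x - u\<^sub>0 x) = 0"
    \<comment> \<open>A real number is its positive part minus its negative part, which is the
      gradient equation; \<open>kkt\<close> contains the complementarity conditions for both
      parts.\<close>
    proof (rule bexI[where x = "\<lambda>x. max (\<xi> x) 0"], rule bexI[where x = "\<lambda>x. max (- \<xi> x) 0"])
      show "AE x in lebesgue_on \<Omega>.
          \<phi> x + \<alpha> * u\<^sub>0 x + \<beta> * (delta_reg p \<gamma> * \<zeta> x - w x) + max (- \<xi> x) 0 - max (\<xi> x) 0 = 0 \<and>
          max (\<xi> x) 0 \<ge> 0 \<and> max (- \<xi> x) 0 \<ge> 0 \<and>
          max (\<xi> x) 0 * (u\<^sub>0 x - u\<^sub>a x) = 0 \<and> max (- \<xi> x) 0 * (u\<^sub>b x - u\<^sub>0 x) = 0"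
        using kkt
      proof eventually_elim
        case (elim x)
        have "\<phi> x + \<alpha> * u\<^sub>0 x + \<beta> * (delta_reg p \<gamma> * \<zeta> x - w x) = \<xi> x"
          by (simp only: \<xi>_eq)
        with elim show ?case by (auto simp: max_def)
      qed
      show "(\<lambda>x. max (- \<xi> x) 0) \<in> L2_space \<Omega>" "(\<lambda>x. max (\<xi> x) 0) \<in> L2_space \<Omega>"
        by (intro pos_part \<xi> neg_\<xi>)+
    qed
  qed
qed

end
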